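(* Let $P$ be a set of $N$ points in $\mathbb{R}^2$, where $N$ is sufficiently large, such that no single straight line contains more than $\frac{N}{2}$ points of $P$. Then: (i) the triangles whose vertices are triples of distinct points of $P$ fall into $\Omega(N^2)$ distinct congruence classes; (ii) the triangles whose vertices are triples of distinct points of $P$ fall into $\Omega\left(\frac{N^2}{\log N}\right)$ distinct similarity classes.
   Context: $X=\Omega(Y)$ means there is a universal constant $c>0$ such that $X\geq cY$; here $N$ is the asymptotic parameter. Two triangles are congruent if one is the image of the other under an isometry of $\mathbb{R}^2$, and similar if one is the image of the other under a similarity transformation (an isometry composed with a dilation) of $\mathbb{R}^2$. *)

theory Defs
  imports "HOL-Analysis.Analysis"
begin

text \<open>A triangle is represented by its set of three vertices; as usual it is non-degenerate.\<close>

definition triangles :: "(real^2) set \<Rightarrow> (real^2) set set" where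
  "triangles P = {T. \<exists>a\<in>P. \<exists>b\<in>P. \<exists>c\<in>P.
     a \<noteq> b \<and> b \<noteq> c \<and> a \<noteq> c \<and> \<not> collinear {a, b, c} \<and> T = {a, b, c}}"

definition is_line :: "(real^2) set \<Rightarrow> bool" where
  "is_line L \<longleftrightarrow> affine L \<and> aff_dim L = 1"

definition plane_isometry :: "(real^2 \<Rightarrow> real^2) \<Rightarrow> bool" where
  "plane_isometry f \<longleftrightarrow> (\<forall>x y. dist (f x) (f y) = dist x y)"

definition dilation :: "real^2 \<Rightarrow> real \<Rightarrow> real^2 \<Rightarrow> real^2" where
  "dilation p r x = p + r *\<^sub>R (x - p)"

definition plane_similarity :: "(real^2 \<Rightarrow> real^2) \<Rightarrow> bool" where
  "plane_similarity f \<longleftrightarrow> (\<exists>g p r. plane_isometry g \<and> r > 0 \<and> f = g \<circ> dilation p r)"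

definition congruence_on :: "(real^2) set \<Rightarrow> ((real^2) set \<times> (real^2) set) set" where
  "congruence_on P = {(S, T). S \<in> triangles P \<and> T \<in> triangles P \<and>
     (\<exists>f. plane_isometry f \<and> f ` S = T)}"

definition similarity_on :: "(real^2) set \<Rightarrow> ((real^2) set \<times> (real^2) set) set" where
  "similarity_on P = {(S, T). S \<in> triangles P \<and> T \<in> triangles P \<and>
     (\<exists>f. plane_similarity f \<and> f ` S = T)}"

definition congruence_classes :: "(real^2) set \<Rightarrow> (real^2) set set set" where
  "congruence_classes P = triangles P // congruence_on P"

definition similarity_classes :: "(real^2) set \<Rightarrow> (real^2) set set set" where
  "similarity_classes P = triangles P // similarity_on P"

lemma plane_isometry_bij:
  assumes "plane_isometry f"
  shows "bij f"
proof -
  have "orthogonal_transformation (\<lambda>x. f x - f 0)"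
    using assms by (simp add: orthogonal_transformation_isometry plane_isometry_def dist_norm)
  then have b: "bij (\<lambda>x. f x - f 0)"
    by (rule orthogonal_transformation_bij)
  have "bij (\<lambda>y. y + f 0)"
    by (rule bij_plus_right)
  from bij_comp[OF b this] show ?thesis
    by (simp add: comp_def)
qed

lemma plane_similarity_iff:
  "plane_similarity f \<longleftrightarrow> (\<exists>r>0. \<forall>x y. dist (f x) (f y) = r * dist x y)"
proof
  assume "plane_similarity f"
  then obtain g p r where g: "plane_isometry g" "r > 0" "f = g \<circ> dilation p r"
    unfolding plane_similarity_def by blast
  have "dist (f x) (f y) = r * dist x y" for x y
  proof -
    have "dist (f x) (f y) = norm (r *\<^sub>R (x - p) - r *\<^sub>R (y - p))"
      using g by (simp add: plane_isometry_def dilation_def dist_norm)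
    also have "\<dots> = norm (r *\<^sub>R (x - y))"
      by (simp add: scaleR_diff_right)
    finally show ?thesis using g(2) by (simp add: dist_norm)
  qed
  with g(2) show "\<exists>r>0. \<forall>x y. dist (f x) (f y) = r * dist x y" by blast
next
  assume "\<exists>r>0. \<forall>x y. dist (f x) (f y) = r * dist x y"
  then obtain r where r: "r > 0" "\<And>x y. dist (f x) (f y) = r * dist x y" by blast
  define g where "g = (\<lambda>x. f (x /\<^sub>R r))"
  have "dist (x /\<^sub>R r) (y /\<^sub>R r) = dist x y / r" for x y :: "real^2"
  proof -
    have "dist (x /\<^sub>R r) (y /\<^sub>R r) = norm ((x - y) /\<^sub>R r)"
      by (simp add: dist_norm scaleR_diff_right)
    also have "\<dots> = dist x y / r"
      using r(1) by (simp add: dist_norm divide_inverse mult.commute)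
    finally show ?thesis .
  qed
  then have "plane_isometry g"
    using r by (simp add: plane_isometry_def g_def)
  moreover have "f = g \<circ> dilation 0 r"
    using r(1) by (auto simp: g_def dilation_def)
  ultimately show "plane_similarity f"
    using r(1) unfolding plane_similarity_def by blast
qed

lemma plane_similarity_bij:
  assumes "plane_similarity f"
  shows "bij f"
proof -
  obtain g p r where g: "plane_isometry g" "r > 0" "f = g \<circ> dilation p r"
    using assms unfolding plane_similarity_def by blast
  have "bij (dilation p r)"
    by (rule o_bij[where g = "dilation p (1 / r)"]) (use g(2) in \<open>auto simp: dilation_def\<close>)
  with g show ?thesis
    using bij_comp plane_isometry_bij by blast
qed

lemma plane_isometry_inv:
  assumes "plane_isometry f"
  shows "plane_isometry (inv f)"
  using assms plane_isometry_bij[OF assms] unfolding plane_isometry_def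
  by (metis bij_inv_eq_iff)

lemma plane_similarity_inv:
  assumes "plane_similarity f"
  shows "plane_similarity (inv f)"
proof -
  obtain r where r: "r > 0" "\<And>x y. dist (f x) (f y) = r * dist x y"
    using assms unfolding plane_similarity_iff by blast
  have "dist (inv f x) (inv f y) = (1 / r) * dist x y" for x y
    using r(1) r(2)[of "inv f x" "inv f y"] plane_similarity_bij[OF assms]
    by (simp add: bij_is_surj surj_f_inv_f)
  moreover have "1 / r > 0" using r(1) by simp
  ultimately show ?thesis unfolding plane_similarity_iff by blast
qed

lemma plane_isometry_comp:
  "plane_isometry f \<Longrightarrow> plane_isometry g \<Longrightarrow> plane_isometry (f \<circ> g)"
  by (simp add: plane_isometry_def)

lemma plane_similarity_comp:
  assumes "plane_similarity f" "plane_similarity g"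
  shows "plane_similarity (f \<circ> g)"
proof -
  obtain r where r: "r > 0" "\<And>x y. dist (f x) (f y) = r * dist x y"
    using assms(1) unfolding plane_similarity_iff by blast
  obtain s where s: "s > 0" "\<And>x y. dist (g x) (g y) = s * dist x y"
    using assms(2) unfolding plane_similarity_iff by blast
  have "r * s > 0" "\<forall>x y. dist ((f \<circ> g) x) ((f \<circ> g) y) = (r * s) * dist x y"
    using r s by simp_all
  then show ?thesis unfolding plane_similarity_iff by blast
qed

lemma equiv_congruence_on: "equiv (triangles P) (congruence_on P)"
proof (rule equivI)
  show "congruence_on P \<subseteq> triangles P \<times> triangles P"
    by (auto simp: congruence_on_def)
  have "plane_isometry id" by (simp add: plane_isometry_def)
  then show "refl_on (triangles P) (congruence_on P)"
    by (auto simp: refl_on_def congruence_on_def intro!: exI[of _ id])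
  show "sym (congruence_on P)"
  proof (rule symI)
    fix S T assume "(S, T) \<in> congruence_on P"
    then obtain f where f: "S \<in> triangles P" "T \<in> triangles P" "plane_isometry f" "f ` S = T"
      by (auto simp: congruence_on_def)
    then have "inv f ` T = S"
      by (metis bij_is_inj image_inv_f_f plane_isometry_bij)
    with f plane_isometry_inv show "(T, S) \<in> congruence_on P"
      by (auto simp: congruence_on_def)
  qed
  show "trans (congruence_on P)"
  proof (rule transI)
    fix S T U assume "(S, T) \<in> congruence_on P" "(T, U) \<in> congruence_on P"
    then obtain f g where fg: "S \<in> triangles P" "U \<in> triangles P"
        "plane_isometry f" "f ` S = T" "plane_isometry g" "g ` T = U"
      by (auto simp: congruence_on_def)
    then have "plane_isometry (g \<circ> f)" "(g \<circ> f) ` S = U"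
      by (auto simp: plane_isometry_comp image_comp[symmetric])
    with fg(1,2) show "(S, U) \<in> congruence_on P"
      unfolding congruence_on_def by blast
  qed
qed

lemma equiv_similarity_on: "equiv (triangles P) (similarity_on P)"
proof (rule equivI)
  show "similarity_on P \<subseteq> triangles P \<times> triangles P"
    by (auto simp: similarity_on_def)
  have "plane_similarity id" by (auto simp: plane_similarity_iff intro: exI[of _ 1])
  then show "refl_on (triangles P) (similarity_on P)"
    by (auto simp: refl_on_def similarity_on_def intro!: exI[of _ id])
  show "sym (similarity_on P)"
  proof (rule symI)
    fix S T assume "(S, T) \<in> similarity_on P"
    then obtain f where f: "S \<in> triangles P" "T \<in> triangles P" "plane_similarity f" "f ` S = T"
      by (auto simp: similarity_on_def)
    then have "inv f ` T = S"
      by (metis bij_is_inj image_inv_f_f plane_similarity_bij)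
    with f plane_similarity_inv show "(T, S) \<in> similarity_on P"
      by (auto simp: similarity_on_def)
  qed
  show "trans (similarity_on P)"
  proof (rule transI)
    fix S T U assume "(S, T) \<in> similarity_on P" "(T, U) \<in> similarity_on P"
    then obtain f g where fg: "S \<in> triangles P" "U \<in> triangles P"
        "plane_similarity f" "f ` S = T" "plane_similarity g" "g ` T = U"
      by (auto simp: similarity_on_def)
    then have "plane_similarity (g \<circ> f)" "(g \<circ> f) ` S = U"
      by (auto simp: plane_similarity_comp image_comp[symmetric])
    with fg(1,2) show "(S, U) \<in> similarity_on P"
      unfolding similarity_on_def by blast
  qed
qed

end

theory Submission
  imports Defs
begin

text \<open>
  Write \<open>r(g)\<close> for the number of points of \<open>P\<close> that a similarity \<open>g\<close> maps into \<open>P\<close>. There are at least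
  \<open>N^3 / 4\<close> ordered non-degenerate triples, so by Cauchy--Schwarz it suffices to bound \<open>\<Sum>g. r(g)^3\<close> by
  \<open>O(N^4)\<close> for isometries and by \<open>O(N^4 log N)\<close> for similarities.

  Join each of the \<open>r(g)\<close> points \<open>p\<close> to its nearest neighbour \<open>q\<close> among them. The closed discs around \<open>p\<close>
  through \<open>q\<close> cover every point of the plane boundedly often, and so do their images under \<open>g\<close>; hence for
  half of the \<open>p\<close> both discs contain \<open>O(N / r(g))\<close> points of \<open>P\<close>. Since \<open>(p, q, g p, g q)\<close> determines \<open>g\<close>
  up to a reflection, \<open>\<Sum>g. r(g)^3\<close> is \<open>O(N^2)\<close> times the sum of \<open>1 / m^2\<close> over quadruples
  \<open>(p, q, p', q')\<close>, where \<open>m\<close> is the larger number of points of \<open>P\<close> in the two discs. Each of the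
  \<open>O(log N)\<close> ranges \<open>16^j \<le> m < 16^(j+1)\<close> contributes \<open>O(N^2)\<close>.

  For isometries \<open>q\<close> also lies on the circle around \<open>p\<close> of radius \<open>dist p' q'\<close>. If that circle has at most
  \<open>8^j\<close> points of \<open>P\<close>, the contribution of the range drops to \<open>O(N^2 / 2^j)\<close>. Otherwise \<open>p\<close> is the centre
  of a circle with more than \<open>8^j\<close> points whose disc has only \<open>O(16^j)\<close> points, and there are only
  \<open>O(N / 4^j)\<close> such \<open>p\<close>. So the logarithm disappears.
\<close>

section \<open>Octants and distances in the plane\<close>

lemma norm_sq_vec2: "(norm (u::real^2))\<^sup>2 = (u$1)\<^sup>2 + (u$2)\<^sup>2"
  unfolding power2_norm_eq_inner inner_vec_def sum_2 by (simp add: power2_eq_square)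

lemma dist_sq_vec2: "(dist (x::real^2) y)\<^sup>2 = (x$1 - y$1)\<^sup>2 + (x$2 - y$2)\<^sup>2"
  by (simp add: dist_norm norm_sq_vec2)

text \<open>The code of one of eight sectors with opening 45 degrees. The arguments below rest on
  this being less than 60 degrees; the type of codes has 8 elements, which explains the factors
  8.\<close>

definition octant :: "real^2 \<Rightarrow> bool \<times> bool \<times> bool" where
  "octant u = (u$1 \<ge> 0, u$2 \<ge> 0, \<bar>u$1\<bar> \<ge> \<bar>u$2\<bar>)"

text \<open>The angle at the origin is at most 45 degrees, hence less than 60, so the side opposite
  to it is not the longest one of the triangle \<open>0\<close>, \<open>u\<close>, \<open>v\<close>.
  Algebraically, \<open>|u - v|^2 < |u|^2\<close> means that \<open>|v|^2\<close> is less than twice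
  the dot product.\<close>

lemma octant_norm_diff_less:
  assumes "octant u = octant v" "norm v \<le> norm u" "v \<noteq> 0"
  shows "norm (u - v) < norm u"
proof -
  \<comment> \<open>\<open>(a, b)\<close> and \<open>(c, d)\<close> are the absolute coordinates of
    \<open>u\<close> and \<open>v\<close>, the larger one first in each pair. Within an octant the
    signs agree, so the dot product is \<open>a * c + b * d\<close>.\<close>
  have key: "c\<^sup>2 + d\<^sup>2 < 2 * (a * c + b * d)"
    if "a \<ge> b" "b \<ge> 0" "c \<ge> d" "d \<ge> 0" "c\<^sup>2 + d\<^sup>2 \<le> a\<^sup>2 + b\<^sup>2" "c > 0" for a b c d :: real
  proof (cases "a > c \<or> a = c \<and> d < c")
    case True
    have "d\<^sup>2 \<le> c * d" "c * d \<le> c * c"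
      using that by (auto simp: power2_eq_square intro: mult_mono)
    have 1: "a * c \<ge> c * c" "b * d \<ge> 0" using that True by (auto intro: mult_right_mono)
    have "a * c > c * c \<or> c * d < c * c" using that True by auto
    then show ?thesis using 1 \<open>d\<^sup>2 \<le> c * d\<close> \<open>c * d \<le> c * c\<close>
      by (auto simp: power2_eq_square)
  next
    case False
    show ?thesis
    proof (cases "a = c")
      case True
      then have "d = c" using False that by auto
      then have "c\<^sup>2 \<le> b\<^sup>2" using that True by auto
      then have "c \<le> b" using that power2_le_imp_le by blast
      then have "b * d > 0" using that \<open>d = c\<close> by auto
      then show ?thesis using True \<open>d = c\<close> by (auto simp: power2_eq_square)
    next
      case 2: False
      then have "a < c" using False by auto
      have "a \<ge> 0" using that by auto
      have "a > 0"
      proof (rule ccontr)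
        assume "\<not> a > 0"
        then have "a = 0" "b = 0" using that by auto
        then have "c\<^sup>2 + d\<^sup>2 \<le> 0" using that by auto
        then show False using that by (auto simp: sum_power2_le_zero_iff)
      qed
      have "b\<^sup>2 \<le> a\<^sup>2" using that by (auto intro: power_mono)
      then have "c\<^sup>2 + d\<^sup>2 \<le> 2 * (a * a)" using that by (auto simp: power2_eq_square)
      also have "\<dots> < 2 * (a * c)" using \<open>a > 0\<close> \<open>a < c\<close> by auto
      also have "\<dots> \<le> 2 * (a * c + b * d)" using that by auto
      finally show ?thesis .
    qed
  qed
  have nn: "(v$1)\<^sup>2 + (v$2)\<^sup>2 \<le> (u$1)\<^sup>2 + (u$2)\<^sup>2"
    using assms(2) by (metis norm_sq_vec2 norm_ge_zero power_mono)
  have p1: "u$1 * v$1 = \<bar>u$1\<bar> * \<bar>v$1\<bar>" "u$2 * v$2 = \<bar>u$2\<bar> * \<bar>v$2\<bar>"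
    using assms(1) by (auto simp: octant_def abs_if)
  have v0: "v$1 \<noteq> 0 \<or> v$2 \<noteq> 0"
    using assms(3) by (auto simp: vec_eq_iff forall_2)
  have "(v$1)\<^sup>2 + (v$2)\<^sup>2 < 2 * (u$1 * v$1 + u$2 * v$2)"
  proof (cases "\<bar>u$1\<bar> \<ge> \<bar>u$2\<bar>")
    case True
    then have "\<bar>v$1\<bar> \<ge> \<bar>v$2\<bar>" using assms(1) by (auto simp: octant_def)
    then show ?thesis using key[of "\<bar>u$2\<bar>" "\<bar>u$1\<bar>" "\<bar>v$2\<bar>" "\<bar>v$1\<bar>"] True nn v0 unfolding p1 by auto
  next
    case False
    then have "\<not> \<bar>v$1\<bar> \<ge> \<bar>v$2\<bar>" using assms(1) by (auto simp: octant_def)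
    then have "v$2 \<noteq> 0" by auto
    then show ?thesis
      using key[of "\<bar>u$1\<bar>" "\<bar>u$2\<bar>" "\<bar>v$1\<bar>" "\<bar>v$2\<bar>"] \<open>\<not> \<bar>v$1\<bar> \<ge> \<bar>v$2\<bar>\<close> False nn
      unfolding p1 by (auto simp: add.commute)
  qed
  then have "(norm (u - v))\<^sup>2 < (norm u)\<^sup>2"
    unfolding norm_sq_vec2 by (simp add: power2_eq_square algebra_simps)
  then show ?thesis using power2_less_imp_less norm_ge_zero by blast
qed

lemma octant_dist_less:
  assumes "octant (p - x) = octant (q - x)" "dist q x \<le> dist p x" "q \<noteq> x"
  shows "dist p q < dist p x"
  using octant_norm_diff_less[of "p - x" "q - x"] assms by (simp add: dist_norm)

text \<open>The two distances fix the dot product of \<open>x - p\<close> with \<open>q - p\<close>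
  and, by Lagrange's identity, the square of the cross product \<open>cr x\<close>. Only the side of
  the line \<open>pq\<close> remains free.\<close>

lemma card_two_distances_le:
  fixes p q :: "real^2"
  assumes "p \<noteq> q" "\<And>x. x \<in> X \<Longrightarrow> dist p x = d \<and> dist q x = e"
  shows "card X \<le> 2"
proof -
  define cr where "cr x = (x$1 - p$1) * (q$2 - p$2) - (x$2 - p$2) * (q$1 - p$1)" for x :: "real^2"
  have "inj_on (\<lambda>x. cr x > 0) X"
  proof (rule inj_onI)
    fix x y assume xy: "x \<in> X" "y \<in> X" "(cr x > 0) = (cr y > 0)"
    define a b u v s t where ab: "a = q$1 - p$1" "b = q$2 - p$2" "u = x$1 - p$1" "v = x$2 - p$2"
      "s = y$1 - p$1" "t = y$2 - p$2"
    have "(dist p x)\<^sup>2 = (dist p y)\<^sup>2" "(dist q x)\<^sup>2 = (dist q y)\<^sup>2"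
      using assms(2) xy by auto
    then have e: "u\<^sup>2 + v\<^sup>2 = s\<^sup>2 + t\<^sup>2" "(a - u)\<^sup>2 + (b - v)\<^sup>2 = (a - s)\<^sup>2 + (b - t)\<^sup>2"
      unfolding dist_sq_vec2 ab by (auto simp: power2_eq_square algebra_simps)
    then have dot: "a * u + b * v = a * s + b * t" by (simp add: power2_eq_square algebra_simps)
    have n0: "a\<^sup>2 + b\<^sup>2 \<noteq> 0"
      using assms(1) by (auto simp: ab vec_eq_iff forall_2)
    have id: "(a\<^sup>2 + b\<^sup>2) * (u\<^sup>2 + v\<^sup>2) = (a * u + b * v)\<^sup>2 + (u * b - v * a)\<^sup>2" for u v
      by (simp add: power2_eq_square algebra_simps)
    have "(u * b - v * a)\<^sup>2 = (s * b - t * a)\<^sup>2"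
      using id[of u v] id[of s t] e(1) dot by simp
    moreover have "(u * b - v * a > 0) = (s * b - t * a > 0)"
      using xy(3) by (simp add: cr_def ab)
    ultimately have cross: "u * b - v * a = s * b - t * a"
      unfolding power2_eq_iff by linarith
    have "(a\<^sup>2 + b\<^sup>2) * u = a * (a * u + b * v) + b * (u * b - v * a)"
         "(a\<^sup>2 + b\<^sup>2) * v = b * (a * u + b * v) - a * (u * b - v * a)"
         "(a\<^sup>2 + b\<^sup>2) * s = a * (a * s + b * t) + b * (s * b - t * a)"
         "(a\<^sup>2 + b\<^sup>2) * t = b * (a * s + b * t) - a * (s * b - t * a)"
      by (simp_all add: power2_eq_square algebra_simps)
    then have "(a\<^sup>2 + b\<^sup>2) * u = (a\<^sup>2 + b\<^sup>2) * s" "(a\<^sup>2 + b\<^sup>2) * v = (a\<^sup>2 + b\<^sup>2) * t"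
      using dot cross by simp_all
    then have "u = s" "v = t" using n0 by auto
    then show "x = y" by (simp add: ab vec_eq_iff forall_2)
  qed
  then have "card X \<le> card (UNIV :: bool set)"
    by (rule card_inj_on_le) auto
  then show ?thesis by simp
qed

section \<open>Discs and circles around points of a finite set\<close>

text \<open>Two centres in one octant as seen from \<open>x\<close> cannot both cover
  \<open>x\<close>: if \<open>p\<close> is the farther one, then \<open>dist p q < dist p x\<close>,
  which is at most \<open>\<delta> p\<close>, against the separation. So \<open>x\<close> is covered
  at most once per octant, and once more if it is a centre itself: 8 + 1 = 9.\<close>

lemma sum_card_cball_separated_le:
  fixes A P :: "(real^2) set"
  assumes "finite A" "finite P" "\<And>p q. p \<in> A \<Longrightarrow> q \<in> A \<Longrightarrow> p \<noteq> q \<Longrightarrow> \<delta> p \<le> dist p q"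
  shows "(\<Sum>p\<in>A. card (P \<inter> cball p (\<delta> p))) \<le> 9 * card P"
proof -
  have "(\<Sum>p\<in>A. card (P \<inter> cball p (\<delta> p))) = (\<Sum>p\<in>A. card {x \<in> P. dist p x \<le> \<delta> p})"
    by (simp add: cball_def Int_def)
  also have "\<dots> = (\<Sum>x\<in>P. card {p \<in> A. dist p x \<le> \<delta> p})"
    by (rule sum_multicount_gen) (use assms in auto)
  also have "\<dots> \<le> (\<Sum>x\<in>P. 9)"
  proof (rule sum_mono)
    fix x assume "x \<in> P"
    let ?B = "{p \<in> A. p \<noteq> x \<and> dist p x \<le> \<delta> p}"
    have "inj_on (\<lambda>p. octant (p - x)) ?B"
    proof (rule inj_onI, rule ccontr)
      fix p q assume pq: "p \<in> ?B" "q \<in> ?B" "octant (p - x) = octant (q - x)" "p \<noteq> q"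
      then have "\<delta> p \<le> dist p q" "\<delta> q \<le> dist p q"
        using assms(3)[of p q] assms(3)[of q p] by (auto simp: dist_commute)
      moreover have "dist p q < dist p x \<or> dist p q < dist q x"
      proof (cases "dist q x \<le> dist p x")
        case True
        then show ?thesis using octant_dist_less[of p x q] pq by auto
      next
        case False
        then show ?thesis using octant_dist_less[of q x p] pq by (auto simp: dist_commute[of p q])
      qed
      ultimately show False using pq by auto
    qed
    then have "card ?B \<le> card (UNIV :: (bool \<times> bool \<times> bool) set)"
      by (rule card_inj_on_le) auto
    then have "card ?B \<le> 8" by simp
    moreover have "card {p \<in> A. dist p x \<le> \<delta> p} \<le> card (insert x ?B)"
      by (rule card_mono) (use assms in auto)
    moreover have "card (insert x ?B) \<le> Suc (card ?B)"
      using assms(1) by (simp add: card_insert_if)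
    ultimately show "card {p \<in> A. dist p x \<le> \<delta> p} \<le> 9" by linarith
  qed
  finally show ?thesis by (simp add: mult.commute)
qed

text \<open>By Cauchy--Schwarz many pairs of the given circles share a point \<open>x\<close>. If the two centres lie in the
  same octant as seen from \<open>x\<close>, then the centre of the smaller circle lies in the disc of the larger one,
  which leaves at most \<open>M\<close> partners for each circle.\<close>

lemma card_rich_circle_centres_le:
  fixes P B :: "(real^2) set"
  assumes fin: "finite P" and BP: "B \<subseteq> P"
    and M: "\<And>p. p \<in> B \<Longrightarrow> card (P \<inter> cball p (d p)) \<le> M"
    and t: "\<And>p. p \<in> B \<Longrightarrow> t \<le> card (P \<inter> sphere p (d p))"
    and pos: "\<And>p. p \<in> B \<Longrightarrow> d p > 0"
  shows "card B * t\<^sup>2 \<le> 320 * M * card P"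
proof -
  have finB: "finite B" using fin BP finite_subset by blast
  define inc where "inc k p x \<longleftrightarrow> x \<in> sphere p (d p) \<and> octant (p - x) = k" for k p x
  define I where "I k = (\<Sum>p\<in>B. card {x \<in> P. inc k p x})" for k
  have I_le: "I k \<le> card B * M" for k
  proof -
    have "card {x \<in> P. inc k p x} \<le> M" if "p \<in> B" for p
      by (rule order_trans[OF card_mono M[OF that]]) (use fin in \<open>auto simp: inc_def\<close>)
    then show ?thesis unfolding I_def using sum_bounded_above[of B _ M] by simp
  qed
  have I_sq: "(I k)\<^sup>2 \<le> 5 * M * card B * card P" for k
  proof -
    define deg where "deg x = card {p \<in> B. inc k p x}" for x
    have I_deg: "I k = (\<Sum>x\<in>P. deg x)"
      unfolding I_def deg_def by (rule sum_multicount_gen) (use fin finB in auto)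
    have cs: "(I k)\<^sup>2 \<le> (\<Sum>x\<in>P. (deg x)\<^sup>2) * card P"
    proof -
      have "(\<Sum>x\<in>P. real (deg x))\<^sup>2 \<le> (\<Sum>x\<in>P. (real (deg x))\<^sup>2) * real (card P)"
        using sum_squared_le_sum_of_squares[of "\<lambda>x. real (deg x)" P] by simp
      then have "real ((I k)\<^sup>2) \<le> real ((\<Sum>x\<in>P. (deg x)\<^sup>2) * card P)"
        by (simp add: I_deg)
      then show ?thesis by (simp only: of_nat_le_iff)
    qed
    define R where "R x p q \<longleftrightarrow> inc k p x \<and> inc k q x" for x p q
    have "(\<Sum>x\<in>P. (deg x)\<^sup>2) = (\<Sum>x\<in>P. card {z \<in> B \<times> B. R x (fst z) (snd z)})"
    proof (rule sum.cong[OF refl])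
      fix x assume "x \<in> P"
      have "{z \<in> B \<times> B. R x (fst z) (snd z)} = {p \<in> B. inc k p x} \<times> {p \<in> B. inc k p x}"
        by (auto simp: R_def)
      then show "(deg x)\<^sup>2 = card {z \<in> B \<times> B. R x (fst z) (snd z)}"
        by (simp add: card_cartesian_product deg_def power2_eq_square)
    qed
    also have "\<dots> = (\<Sum>z\<in>B \<times> B. card {x \<in> P. R x (fst z) (snd z)})"
      by (rule sum_multicount_gen) (use fin finB in auto)
    \<comment> \<open>The diagonal contributes \<open>I k\<close>, at most
      \<open>card B * M\<close>. Two different circles share at most two points, charged to a centre
      that lies in the other disc; the two symmetric terms contribute at most
      \<open>2 * M * card B\<close> each. Hence the factor 5.\<close>
    also have "\<dots> \<le> (\<Sum>z\<in>B \<times> B. (if fst z = snd z then card {x \<in> P. inc k (fst z) x} else 0)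
        + (if fst z \<in> cball (snd z) (d (snd z)) then 2 else 0)
        + (if snd z \<in> cball (fst z) (d (fst z)) then 2 else 0))"
    proof (rule sum_mono)
      fix z assume "z \<in> B \<times> B"
      then obtain p q where z: "z = (p, q)" "p \<in> B" "q \<in> B" by auto
      show "card {x \<in> P. R x (fst z) (snd z)} \<le> (if fst z = snd z then card {x \<in> P. inc k (fst z) x} else 0)
        + (if fst z \<in> cball (snd z) (d (snd z)) then 2 else 0)
        + (if snd z \<in> cball (fst z) (d (fst z)) then 2 else 0)"
      proof (cases "p = q \<or> {x \<in> P. R x p q} = {}")
        case True
        then show ?thesis
        proof
          assume "p = q"
          then show ?thesis by (simp add: z R_def)
        next
          assume e: "{x \<in> P. R x p q} = {}"
          have "{x \<in> P. R x (fst z) (snd z)} = {}" using e by (simp only: z fst_conv snd_conv)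
          then show ?thesis by (simp only: card.empty)
        qed
      next
        case False
        then obtain x where x: "dist p x = d p" "dist q x = d q" "octant (p - x) = octant (q - x)"
          by (auto simp: R_def inc_def)
        have "p \<noteq> x" "q \<noteq> x" using pos[of p] pos[of q] z x by auto
        then have "p \<in> cball q (d q) \<or> q \<in> cball p (d p)"
          using octant_dist_less[of p x q] octant_dist_less[of q x p] x
          by (metis dist_commute less_imp_le linear mem_cball)
        moreover have "card {x \<in> P. R x p q} \<le> 2"
          by (rule card_two_distances_le[of p q _ "d p" "d q"]) (use False in \<open>auto simp: R_def inc_def\<close>)
        ultimately show ?thesis by (auto simp: z)
      qed
    qed
    also have "\<dots> = (\<Sum>p\<in>B. \<Sum>q\<in>B. (if p = q then card {x \<in> P. inc k p x} else 0))
        + (\<Sum>p\<in>B. \<Sum>q\<in>B. if p \<in> cball q (d q) then 2 else 0)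
        + (\<Sum>p\<in>B. \<Sum>q\<in>B. if q \<in> cball p (d p) then 2 else 0)"
      by (simp add: sum.cartesian_product case_prod_unfold sum.distrib)
    also have "(\<Sum>p\<in>B. \<Sum>q\<in>B. (if p = q then card {x \<in> P. inc k p x} else 0)) = I k"
      unfolding I_def using finB by (simp add: sum.delta)
    also have "(\<Sum>p\<in>B. \<Sum>q\<in>B. if p \<in> cball q (d q) then 2 else (0::nat))
        = (\<Sum>p\<in>B. \<Sum>q\<in>B. if q \<in> cball p (d p) then 2 else 0)"
      by (rule sum.swap)
    also have "(\<Sum>p\<in>B. \<Sum>q\<in>B. if q \<in> cball p (d p) then 2 else (0::nat)) \<le> (\<Sum>p\<in>B. 2 * M)"
    proof (rule sum_mono)
      fix p assume p: "p \<in> B"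
      have "(\<Sum>q\<in>B. if q \<in> cball p (d p) then 2 else (0::nat)) = 2 * card {q \<in> B. q \<in> cball p (d p)}"
        using finB by (simp add: sum.If_cases Int_def mult.commute)
      also have "\<dots> \<le> 2 * card (P \<inter> cball p (d p))"
        using fin BP by (intro mult_left_mono card_mono) auto
      also have "\<dots> \<le> 2 * M" using M[OF p] by simp
      finally show "(\<Sum>q\<in>B. if q \<in> cball p (d p) then 2 else (0::nat)) \<le> 2 * M" .
    qed
    finally have "(\<Sum>x\<in>P. (deg x)\<^sup>2) \<le> 5 * M * card B"
      using I_le[of k] by (simp add: algebra_simps)
    then show ?thesis using cs by (meson le_trans mult_le_mono1)
  qed
  have "card B * t \<le> (\<Sum>p\<in>B. \<Sum>k\<in>UNIV. card {x \<in> P. inc k p x})"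
  proof -
    have "t \<le> (\<Sum>k\<in>UNIV. card {x \<in> P. inc k p x})" if "p \<in> B" for p
    proof -
      have "P \<inter> sphere p (d p) = (\<Union>k\<in>UNIV. {x \<in> P. inc k p x})" by (auto simp: inc_def)
      then have "card (P \<inter> sphere p (d p)) \<le> (\<Sum>k\<in>UNIV. card {x \<in> P. inc k p x})"
        using card_UN_le[of "UNIV :: (bool \<times> bool \<times> bool) set" "\<lambda>k. {x \<in> P. inc k p x}"] by simp
      then show ?thesis using t[OF that] by linarith
    qed
    then show ?thesis using sum_bounded_below[of B t] by simp
  qed
  also have "\<dots> = (\<Sum>k\<in>UNIV. I k)" unfolding I_def by (rule sum.swap)
  finally have "real (card B * t) \<le> (\<Sum>k\<in>UNIV. real (I k))"
    by (metis of_nat_le_iff of_nat_sum)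
  then have "(real (card B * t))\<^sup>2 \<le> (\<Sum>k\<in>UNIV. real (I k))\<^sup>2" by (rule power_mono) simp
  \<comment> \<open>Cauchy-Schwarz over the 8 octants. Together with 8 summands of factor 5 this
    yields 8 * 8 * 5 = 320.\<close>
  also have "\<dots> \<le> (\<Sum>k\<in>UNIV. (real (I k))\<^sup>2) * 8"
    using sum_squared_le_sum_of_squares[of "\<lambda>k. real (I k)" "UNIV"] by simp
  also have "\<dots> \<le> (\<Sum>k\<in>(UNIV :: (bool \<times> bool \<times> bool) set). real (5 * M * card B * card P)) * 8"
    using I_sq by (intro mult_right_mono sum_mono) (metis of_nat_le_iff of_nat_power, simp)
  finally have "real ((card B * t)\<^sup>2) \<le> real (320 * M * card B * card P)" by simp
  then have "(card B * t)\<^sup>2 \<le> 320 * M * card B * card P" by (simp only: of_nat_le_iff)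
  then have "card B * (card B * t\<^sup>2) \<le> card B * (320 * M * card P)"
    by (simp add: power2_eq_square algebra_simps)
  then show ?thesis by (cases "card B = 0") auto
qed

section \<open>Points and segments matched by a similarity\<close>

text \<open>The pairs are \<open>(p, n p)\<close> with \<open>n p\<close> a nearest neighbour of
  \<open>p\<close> in \<open>A\<close>. The covering bound 9 for the discs and again for their
  images makes the average of \<open>h1 + h2\<close> at most \<open>18 * card P / card A\<close>; by
  Markov's inequality at most half of the points exceed twice that.\<close>

lemma card_le_good_pairs:
  fixes P :: "(real^2) set"
  assumes fin: "finite P" and g: "plane_similarity g"
    and A_def: "A = {p \<in> P. g p \<in> P}" and A2: "card A \<ge> 2"
  shows "card A \<le> 2 * card {(p, q). p \<in> A \<and> q \<in> A \<and> p \<noteq> q \<and>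
     card A * card (P \<inter> cball p (dist p q)) \<le> 36 * card P \<and>
     card A * card (P \<inter> cball (g p) (dist (g p) (g q))) \<le> 36 * card P}"
    (is "_ \<le> 2 * card ?G")
proof -
  obtain r where r: "r > 0" "\<And>x y. dist (g x) (g y) = r * dist x y"
    using g plane_similarity_iff by auto
  have finA: "finite A" using fin A_def by auto
  have inj: "inj g" using g plane_similarity_bij bij_is_inj by auto
  have "\<exists>q\<in>A - {p}. \<forall>q'\<in>A - {p}. dist p q \<le> dist p q'" if "p \<in> A" for p
  proof -
    have "card (A - {p}) \<ge> 1" using A2 that finA by simp
    then have "A - {p} \<noteq> {}" by (metis card.empty not_one_le_zero)
    then show ?thesis using finA
      by (metis (no_types, lifting) finite_Diff arg_min_least arg_min_if_finite(1))
  qed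
  then obtain n where n: "\<And>p. p \<in> A \<Longrightarrow> n p \<in> A \<and> n p \<noteq> p"
    "\<And>p q. p \<in> A \<Longrightarrow> q \<in> A \<Longrightarrow> p \<noteq> q \<Longrightarrow> dist p (n p) \<le> dist p q"
    by (metis DiffD1 DiffD2 DiffI insertI1 singletonD)
  define h1 where "h1 p = card (P \<inter> cball p (dist p (n p)))" for p
  define h2 where "h2 p = card (P \<inter> cball (g p) (dist (g p) (g (n p))))" for p
  have s1: "(\<Sum>p\<in>A. h1 p) \<le> 9 * card P"
    unfolding h1_def by (rule sum_card_cball_separated_le) (use fin finA n in auto)
  \<comment> \<open>All distances are scaled by \<open>r\<close>, so \<open>g (n p)\<close> is a
    nearest neighbour of \<open>g p\<close> within the image of \<open>A\<close>, and the covering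
    bound applies there too.\<close>
  have "(\<Sum>p\<in>A. h2 p) = (\<Sum>p\<in>g ` A. card (P \<inter> cball p (dist p (g (n (inv g p))))))"
    using inj by (simp add: sum.reindex inj_on_subset h2_def)
  also have "\<dots> \<le> 9 * card P"
  proof (rule sum_card_cball_separated_le)
    fix p q assume "p \<in> g ` A" "q \<in> g ` A" "p \<noteq> q"
    then obtain x y where "x \<in> A" "y \<in> A" "p = g x" "q = g y" "x \<noteq> y" by auto
    then show "dist p (g (n (inv g p))) \<le> dist p q"
      using n(2)[of x y] r inj by simp
  qed (use fin finA in auto)
  finally have "(\<Sum>p\<in>A. h1 p + h2 p) \<le> 18 * card P" using s1 by (simp add: sum.distrib)
  then have s: "(\<Sum>p\<in>A. card A * (h1 p + h2 p)) \<le> card A * (18 * card P)"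
    by (simp only: sum_distrib_left[symmetric] mult_le_mono2)
  define A1 where "A1 = {p \<in> A. card A * (h1 p + h2 p) \<le> 36 * card P}"
  have "card (A - A1) * (36 * card P) \<le> (\<Sum>p\<in>A - A1. card A * (h1 p + h2 p))"
    using sum_bounded_below[of "A - A1" "36 * card P" "\<lambda>p. card A * (h1 p + h2 p)"]
    by (simp add: A1_def not_le less_imp_le)
  also have "\<dots> \<le> (\<Sum>p\<in>A. card A * (h1 p + h2 p))"
    by (rule sum_mono2) (use finA in auto)
  also note s
  finally have "(2 * card (A - A1)) * (18 * card P) \<le> card A * (18 * card P)" by simp
  moreover have "card P > 0"
    using A2 card_mono[of P A] fin by (auto simp: A_def)
  ultimately have "2 * card (A - A1) \<le> card A" by simp
  moreover have "card (A - A1) = card A - card A1"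
    by (rule card_Diff_subset) (use finA in \<open>auto simp: A1_def\<close>)
  moreover have "card A1 \<le> card A" by (rule card_mono) (use finA in \<open>auto simp: A1_def\<close>)
  ultimately have "card A \<le> 2 * card A1" by linarith
  also have "card A1 \<le> card ?G"
  proof (rule card_inj_on_le[of "\<lambda>p. (p, n p)"])
    show "inj_on (\<lambda>p. (p, n p)) A1" by (auto simp: inj_on_def)
    show "(\<lambda>p. (p, n p)) ` A1 \<subseteq> ?G"
    proof
      fix z assume "z \<in> (\<lambda>p. (p, n p)) ` A1"
      then obtain p where p: "z = (p, n p)" "p \<in> A" "card A * (h1 p + h2 p) \<le> 36 * card P"
        by (auto simp: A1_def)
      moreover have "p \<noteq> n p" "n p \<in> A" using n(1)[OF p(2)] by auto
      ultimately show "z \<in> ?G" unfolding h1_def h2_def by (simp add: add_mult_distrib2)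
    qed
    show "finite ?G" by (rule finite_subset[of _ "A \<times> A"]) (use finA in auto)
  qed
  finally show ?thesis by simp
qed

text \<open>\<open>w\<close> is \<open>q\<close> turned by a right angle about \<open>p\<close>.
  Seen from the image of \<open>p\<close>, the images of \<open>q\<close> and \<open>w\<close> are
  orthogonal vectors of equal nonzero length. Since \<open>f y\<close> and \<open>g y\<close> have
  equal distances to the three images, their difference is orthogonal to both vectors and so
  vanishes.\<close>

lemma similarities_eqI:
  assumes f: "\<And>x y. dist (f x) (f y) = r * dist x y" and g: "\<And>x y. dist (g x) (g y) = r * dist x y"
    and r: "r > 0" and pq: "p \<noteq> (q::real^2)" "f p = g p" "f q = g q"
    and w: "w = p + vector [-(q$2 - p$2), q$1 - p$1]" and fw: "f w = g w"
  shows "f = (g :: real^2 \<Rightarrow> real^2)"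
proof
  fix y
  have eqd: "(dist (f y) (f p))\<^sup>2 = (dist (g y) (f p))\<^sup>2" "(dist (f y) (f q))\<^sup>2 = (dist (g y) (f q))\<^sup>2"
       "(dist (f y) (f w))\<^sup>2 = (dist (g y) (f w))\<^sup>2"
    using f[of y] g[of y] pq fw by metis+
  define a b where "a = f q $ 1 - f p $ 1" "b = f q $ 2 - f p $ 2"
  define c d where "c = f w $ 1 - f p $ 1" "d = f w $ 2 - f p $ 2"
  define s t where "s = f y $ 1 - g y $ 1" "t = f y $ 2 - g y $ 2"
  have d1: "(dist p w)\<^sup>2 = (dist p q)\<^sup>2" "(dist q w)\<^sup>2 = 2 * (dist p q)\<^sup>2"
    unfolding dist_sq_vec2 w by (simp_all add: power2_eq_square algebra_simps)
  have d2: "(dist (f p) (f w))\<^sup>2 = (dist (f p) (f q))\<^sup>2" "(dist (f q) (f w))\<^sup>2 = 2 * (dist (f p) (f q))\<^sup>2"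
    using d1 by (simp_all add: f power_mult_distrib)
  have "f p \<noteq> f q" using f[of p q] r pq by auto
  then have ab0: "a\<^sup>2 + b\<^sup>2 \<noteq> 0" by (auto simp: a_b_def vec_eq_iff forall_2)
  have cd: "c\<^sup>2 + d\<^sup>2 = a\<^sup>2 + b\<^sup>2" and ac: "a * c + b * d = 0"
    using d2 unfolding dist_sq_vec2 a_b_def c_d_def by (simp_all add: power2_eq_square algebra_simps)
  have st: "s * a + t * b = 0" "s * c + t * d = 0"
    using eqd unfolding dist_sq_vec2 a_b_def c_d_def s_t_def by (simp_all add: power2_eq_square algebra_simps)
  have "(a\<^sup>2 + b\<^sup>2) * (a * d - b * c) = 0 \<Longrightarrow> False"
  proof -
    assume "(a\<^sup>2 + b\<^sup>2) * (a * d - b * c) = 0"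
    then have "a * d - b * c = 0" using ab0 by auto
    moreover have "(a\<^sup>2 + b\<^sup>2) * (c\<^sup>2 + d\<^sup>2) = (a * c + b * d)\<^sup>2 + (a * d - b * c)\<^sup>2"
      by (simp add: power2_eq_square algebra_simps)
    ultimately show False using ac cd ab0 by simp
  qed
  then have det: "a * d - b * c \<noteq> 0" by auto
  have "s * (a * d - b * c) = (s * a + t * b) * d - (s * c + t * d) * b"
       "t * (a * d - b * c) = (s * c + t * d) * a - (s * a + t * b) * c"
    by (simp_all add: algebra_simps)
  then have "s = 0" "t = 0" using st det by auto
  then show "f y = g y" by (simp add: s_t_def vec_eq_iff forall_2)
qed

text \<open>All members of \<open>G\<close> share the ratio \<open>r\<close> read off from the
  segment \<open>pq\<close>. By \<open>similarities_eqI\<close> each is determined by the image of a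
  third point \<open>w\<close>, and this image lies on given circles around \<open>p'\<close> and
  \<open>q'\<close>.\<close>

lemma card_similarities_through_le:
  fixes p q p' q' :: "real^2"
  assumes "p \<noteq> q" "\<And>g. g \<in> G \<Longrightarrow> plane_similarity g \<and> g p = p' \<and> g q = q'"
  shows "card G \<le> 2"
proof (cases "G = {}")
  case False
  then obtain g0 where g0: "g0 \<in> G" by auto
  then obtain r where r: "r > 0" "\<And>x y. dist (g0 x) (g0 y) = r * dist x y"
    using assms(2)[OF g0] unfolding plane_similarity_iff by auto
  have dist_G: "dist (g x) (g y) = r * dist x y" if gG: "g \<in> G" for g x y
  proof -
    obtain r' where r': "r' > 0" "\<And>x y. dist (g x) (g y) = r' * dist x y"
      using assms(2)[OF gG] unfolding plane_similarity_iff by auto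
    have "dist (g p) (g q) = dist (g0 p) (g0 q)" using assms(2)[OF gG] assms(2)[OF g0] by simp
    then have "r' * dist p q = r * dist p q" using r' r by simp
    then have "r' = r" using assms(1) by simp
    then show ?thesis using r' by simp
  qed
  define w where "w = p + vector [-(q$2 - p$2), q$1 - p$1]"
  have "inj_on (\<lambda>g. g w) G"
  proof (rule inj_onI)
    fix f g assume fg: "f \<in> G" "g \<in> G" "f w = g w"
    show "f = g"
      by (rule similarities_eqI[OF dist_G[OF fg(1)] dist_G[OF fg(2)] r(1) assms(1) _ _ w_def fg(3)])
        (use assms(2)[OF fg(1)] assms(2)[OF fg(2)] in auto)
  qed
  then have "card G = card ((\<lambda>g. g w) ` G)" by (simp add: card_image)
  also have "\<dots> \<le> 2"
  proof (rule card_two_distances_le)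
    have "dist p' q' = r * dist p q" using r(2)[of p q] assms(2)[OF g0] by simp
    then show "p' \<noteq> q'" using r(1) assms(1) by auto
    fix x assume "x \<in> (\<lambda>g. g w) ` G"
    then obtain g where g: "g \<in> G" "x = g w" by auto
    show "dist p' x = r * dist p w \<and> dist q' x = r * dist q w"
      using assms(2)[OF g(1)] dist_G[OF g(1), of p w] dist_G[OF g(1), of q w] g(2) by simp
  qed
  finally show ?thesis .
qed simp

text \<open>If a similarity preserves \<open>k\<close> points of \<open>P\<close> and maps the segment \<open>pq\<close> to \<open>p'q'\<close>, where \<open>q\<close> is the
  nearest to \<open>p\<close> among the preserved points, then usually \<open>k = O(card P / reach P (p, q, p', q'))\<close>.\<close>

definition reach :: "(real^2) set \<Rightarrow> (real^2) \<times> (real^2) \<times> (real^2) \<times> (real^2) \<Rightarrow> nat" where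
  "reach P z = (case z of (p, q, p', q') \<Rightarrow>
     max (card (P \<inter> cball p (dist p q))) (card (P \<inter> cball p' (dist p' q'))))"

text \<open>Let \<open>g\<close> preserve \<open>k\<close> points. At least \<open>k / 2\<close>
  good pairs have \<open>k\<close> at most \<open>36 * card P / reach\<close>, so \<open>k^3\<close>
  is at most the sum of \<open>2 * k^2\<close> over them, hence of \<open>w\<close> over the
  quadruples of \<open>Q\<close> realised by \<open>g\<close>. Exchanging the sums costs a second
  factor 2, as at most two members of \<open>G\<close> realise the same quadruple.\<close>

lemma sum_cubed_richness_le:
  fixes P :: "(real^2) set"
  assumes fin: "finite P" "finite G" "finite Q"
    and sim: "\<And>g. g \<in> G \<Longrightarrow> plane_similarity g"
    and rich: "\<And>g. g \<in> G \<Longrightarrow> card {p \<in> P. g p \<in> P} \<ge> 2"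
    and Q: "\<And>g p q. g \<in> G \<Longrightarrow> p \<in> P \<Longrightarrow> q \<in> P \<Longrightarrow> g p \<in> P \<Longrightarrow> g q \<in> P \<Longrightarrow> p \<noteq> q \<Longrightarrow>
      (p, q, g p, g q) \<in> Q"
    and Q_distinct: "\<And>p q p' q'. (p, q, p', q') \<in> Q \<Longrightarrow> p \<noteq> q"
  shows "(\<Sum>g\<in>G. real (card {p \<in> P. g p \<in> P}) ^ 3)
    \<le> 4 * (36 * real (card P))\<^sup>2 * (\<Sum>z\<in>Q. 1 / (real (reach P z))\<^sup>2)"
proof -
  define w where "w z = 2 * (36 * real (card P))\<^sup>2 * (1 / (real (reach P z))\<^sup>2)" for z
  define thru where "thru g z \<longleftrightarrow> (case z of (p, q, p', q') \<Rightarrow> g p = p' \<and> g q = q')"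
    for g :: "real^2 \<Rightarrow> real^2" and z
  have w0: "w z \<ge> 0" for z by (simp add: w_def)
  have "real (card {p \<in> P. g p \<in> P}) ^ 3 \<le> (\<Sum>z | z \<in> Q \<and> thru g z. w z)" if g: "g \<in> G" for g
  proof -
    define A where "A = {p \<in> P. g p \<in> P}"
    define H where "H = {(p, q). p \<in> A \<and> q \<in> A \<and> p \<noteq> q \<and>
     card A * card (P \<inter> cball p (dist p q)) \<le> 36 * card P \<and>
     card A * card (P \<inter> cball (g p) (dist (g p) (g q))) \<le> 36 * card P}"
    have finH: "finite H"
      by (rule finite_subset[of _ "P \<times> P"]) (use fin in \<open>auto simp: H_def A_def\<close>)
    have AH: "card A \<le> 2 * card H"
      unfolding H_def by (rule card_le_good_pairs[OF fin(1) sim[OF g] A_def]) (use rich[OF g] in \<open>simp add: A_def\<close>)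
    have lw: "2 * (real (card A))\<^sup>2 \<le> w (p, q, g p, g q)" if "(p, q) \<in> H" for p q
    proof -
      have "p \<in> P" using that by (auto simp: H_def A_def)
      then have "p \<in> P \<inter> cball p (dist p q)" by auto
      then have "card (P \<inter> cball p (dist p q)) > 0" using fin by (auto simp: card_gt_0_iff)
      then have m0: "reach P (p, q, g p, g q) > 0" by (auto simp: reach_def)
      have "card A * reach P (p, q, g p, g q) \<le> 36 * card P"
        using that by (auto simp: reach_def H_def max_def)
      then have "real (card A) * real (reach P (p, q, g p, g q)) \<le> 36 * real (card P)"
        by (metis of_nat_le_iff of_nat_mult of_nat_numeral)
      then have "real (card A) \<le> 36 * real (card P) / real (reach P (p, q, g p, g q))"
        using m0 by (simp add: pos_le_divide_eq)
      then have "(real (card A))\<^sup>2 \<le> (36 * real (card P) / real (reach P (p, q, g p, g q)))\<^sup>2"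
        by (rule power_mono) simp
      then show ?thesis by (simp add: w_def power_divide)
    qed
    have "real (card A) ^ 3 = real (card A) * (real (card A))\<^sup>2" by (simp add: power3_eq_cube power2_eq_square)
    also have "\<dots> \<le> real (2 * card H) * (real (card A))\<^sup>2"
      using AH by (intro mult_right_mono) (simp_all only: of_nat_le_iff zero_le_power2)
    also have "\<dots> = (\<Sum>h\<in>H. 2 * (real (card A))\<^sup>2)" by simp
    also have "\<dots> \<le> (\<Sum>h\<in>H. w (fst h, snd h, g (fst h), g (snd h)))"
      by (rule sum_mono) (use lw in auto)
    also have "\<dots> = (\<Sum>z\<in>(\<lambda>h. (fst h, snd h, g (fst h), g (snd h))) ` H. w z)"
      by (subst sum.reindex) (auto simp: inj_on_def)
    also have "\<dots> \<le> (\<Sum>z | z \<in> Q \<and> thru g z. w z)"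
    proof (rule sum_mono2)
      show "(\<lambda>h. (fst h, snd h, g (fst h), g (snd h))) ` H \<subseteq> {z. z \<in> Q \<and> thru g z}"
        using Q[OF g] by (auto simp: H_def A_def thru_def)
    qed (use fin w0 in auto)
    finally show ?thesis by (simp add: A_def)
  qed
  then have "(\<Sum>g\<in>G. real (card {p \<in> P. g p \<in> P}) ^ 3) \<le> (\<Sum>g\<in>G. \<Sum>z | z \<in> Q \<and> thru g z. w z)"
    by (rule sum_mono)
  also have "\<dots> = (\<Sum>z\<in>Q. \<Sum>g | g \<in> G \<and> thru g z. w z)"
    by (rule sum.swap_restrict) (use fin in auto)
  also have "\<dots> \<le> (\<Sum>z\<in>Q. 2 * w z)"
  proof (rule sum_mono)
    fix z assume z: "z \<in> Q"
    obtain p q p' q' where zz: "z = (p, q, p', q')" by (metis prod.exhaust)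
    have "card {g. g \<in> G \<and> thru g z} \<le> 2"
      by (rule card_similarities_through_le[of p q _ p' q'])
        (use z zz Q_distinct sim in \<open>auto simp: thru_def\<close>)
    then have "real (card {g. g \<in> G \<and> thru g z}) \<le> 2" by simp
    from mult_right_mono[OF this w0[of z]]
    show "(\<Sum>g | g \<in> G \<and> thru g z. w z) \<le> 2 * w z" by simp
  qed
  also have "\<dots> = 4 * (36 * real (card P))\<^sup>2 * (\<Sum>z\<in>Q. 1 / (real (reach P z))\<^sup>2)"
    by (simp add: w_def sum_distrib_left)
  finally show ?thesis .
qed

section \<open>Counting quadruples by ranges of \<open>reach\<close>\<close>

text \<open>If \<open>s z\<close> is the range of \<open>z\<close>, then \<open>16 ^ s z\<close> is
  at most \<open>m z\<close> and the term is at most \<open>1 / 256 ^ s z\<close>. The counts on the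
  right are cumulative, the form in which they are bounded below.\<close>

lemma sum_inverse_square_dyadic_le:
  fixes m :: "'a \<Rightarrow> nat"
  assumes "finite Q" "\<And>z. z \<in> Q \<Longrightarrow> m z \<ge> 1" "\<And>z. z \<in> Q \<Longrightarrow> m z < 16 ^ J"
  shows "(\<Sum>z\<in>Q. 1 / (real (m z))\<^sup>2) \<le> (\<Sum>j<J. real (card {z \<in> Q. m z \<le> 16 ^ Suc j}) / 256 ^ j)"
proof -
  have "\<exists>j<J. 16 ^ j \<le> m z \<and> m z \<le> 16 ^ Suc j" if "z \<in> Q" for z
  proof -
    define k where "k = (LEAST k. m z < 16 ^ k)"
    have k: "m z < 16 ^ k" unfolding k_def by (rule LeastI[of _ J]) (use assms that in auto)
    have "k \<le> J" unfolding k_def by (rule Least_le) (use assms that in auto)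
    have "k \<noteq> 0" using k assms(2)[OF that] by (cases k) auto
    then obtain j where j: "k = Suc j" by (cases k) auto
    have "\<not> m z < 16 ^ j" using not_less_Least[of j "\<lambda>k. m z < 16 ^ k"] j k_def by auto
    then show ?thesis using k j \<open>k \<le> J\<close> by (intro exI[of _ j]) auto
  qed
  then obtain s where s: "\<And>z. z \<in> Q \<Longrightarrow> s z < J \<and> 16 ^ s z \<le> m z \<and> m z \<le> 16 ^ Suc (s z)"
    by metis
  have "(\<Sum>z\<in>Q. 1 / (real (m z))\<^sup>2) \<le> (\<Sum>z\<in>Q. 1 / 256 ^ s z)"
  proof (rule sum_mono)
    fix z assume z: "z \<in> Q"
    have "real (16 ^ s z) \<le> real (m z)" using s[OF z] by (simp only: of_nat_le_iff)
    then have "(real (16 ^ s z))\<^sup>2 \<le> (real (m z))\<^sup>2" by (rule power_mono) simp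
    moreover have "(real (16 ^ s z))\<^sup>2 = 256 ^ s z"
      by (simp add: power2_eq_square power_mult_distrib[symmetric])
    ultimately have "256 ^ s z \<le> (real (m z))\<^sup>2" by (simp only:)
    then show "1 / (real (m z))\<^sup>2 \<le> 1 / 256 ^ s z"
      using assms(2)[OF z] by (intro divide_left_mono) auto
  qed
  also have "\<dots> = (\<Sum>j<J. \<Sum>z\<in>{z \<in> Q. s z = j}. 1 / 256 ^ s z)"
    by (rule sum.group[symmetric]) (use assms s in auto)
  also have "\<dots> \<le> (\<Sum>j<J. real (card {z \<in> Q. m z \<le> 16 ^ Suc j}) / 256 ^ j)"
  proof (rule sum_mono)
    fix j
    have "(\<Sum>z\<in>{z \<in> Q. s z = j}. 1 / (256::real) ^ s z) = (\<Sum>z\<in>{z \<in> Q. s z = j}. 1 / 256 ^ j)"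
      by (rule sum.cong) auto
    also have "\<dots> = real (card {z \<in> Q. s z = j}) / 256 ^ j" by simp
    also have "\<dots> \<le> real (card {z \<in> Q. m z \<le> 16 ^ Suc j}) / 256 ^ j"
    proof (intro divide_right_mono of_nat_mono card_mono)
      show "{z \<in> Q. s z = j} \<subseteq> {z \<in> Q. m z \<le> 16 ^ Suc j}" using s by blast
    qed (use assms in auto)
    finally show "(\<Sum>z\<in>{z \<in> Q. s z = j}. 1 / (256::real) ^ s z)
      \<le> real (card {z \<in> Q. m z \<le> 16 ^ Suc j}) / 256 ^ j" .
  qed
  finally show ?thesis .
qed

text \<open>Discs around one centre are nested: all these points lie in the disc through the
  farthest of them, which has at most \<open>m\<close> points by choice.\<close>

lemma card_near_le:
  fixes P :: "'a::metric_space set"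
  assumes "finite P"
  shows "card {q \<in> P. card (P \<inter> cball p (dist p q)) \<le> m} \<le> m"
proof (cases "{q \<in> P. card (P \<inter> cball p (dist p q)) \<le> m} = {}")
  case False
  let ?X = "{q \<in> P. card (P \<inter> cball p (dist p q)) \<le> m}"
  have finX: "finite (dist p ` ?X)" "dist p ` ?X \<noteq> {}" using assms False by auto
  then have "Max (dist p ` ?X) \<in> dist p ` ?X" by (rule Max_in)
  then obtain q where q: "q \<in> ?X" "Max (dist p ` ?X) = dist p q" by auto
  have "?X \<subseteq> P \<inter> cball p (dist p q)"
    using Max_ge[OF finX(1)] q by auto
  then have "card ?X \<le> card (P \<inter> cball p (dist p q))" using assms by (intro card_mono) auto
  then show ?thesis using q by simp
qed (simp only: card.empty)

text \<open>Both halves \<open>(p, q)\<close> and \<open>(p', q')\<close> of a quadruple from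
  \<open>P\<close> with \<open>reach\<close> at most \<open>m\<close> lie in this set.\<close>

definition segments_within :: "(real^2) set \<Rightarrow> nat \<Rightarrow> ((real^2) \<times> (real^2)) set" where
  "segments_within P m = (SIGMA p:P. {q \<in> P. card (P \<inter> cball p (dist p q)) \<le> m})"

lemma finite_segments_within: "finite P \<Longrightarrow> finite (segments_within P m)"
  by (auto simp: segments_within_def)

text \<open>The centres range over any \<open>B\<close>, so that the bound also serves for the few
  centres of rich circles.\<close>

lemma card_segments_within_le:
  assumes "finite P" "B \<subseteq> P"
  shows "card (SIGMA p:B. {q \<in> P. card (P \<inter> cball p (dist p q)) \<le> m}) \<le> card B * m"
proof -
  have "finite B" using assms finite_subset by blast
  then have "card (SIGMA p:B. {q \<in> P. card (P \<inter> cball p (dist p q)) \<le> m})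
    = (\<Sum>p\<in>B. card {q \<in> P. card (P \<inter> cball p (dist p q)) \<le> m})"
    using assms by simp
  also have "\<dots> \<le> of_nat (card B) * m"
    by (rule sum_bounded_above) (rule card_near_le[OF assms(1)])
  finally show ?thesis by simp
qed

text \<open>The two halves are chosen independently, each in at most \<open>card P * m\<close>
  ways.\<close>

lemma card_reach_le:
  assumes fin: "finite P" and Q: "Q \<subseteq> P \<times> P \<times> P \<times> P"
  shows "card {z \<in> Q. reach P z \<le> m} \<le> (card P * m)\<^sup>2"
proof -
  let ?X = "segments_within P m"
  have "{z \<in> Q. reach P z \<le> m} \<subseteq> (\<lambda>((p, q), p', q'). (p, q, p', q')) ` (?X \<times> ?X)"
    using Q by (force simp: reach_def segments_within_def)
  then have "card {z \<in> Q. reach P z \<le> m} \<le> card (?X \<times> ?X)"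
    by (rule surj_card_le[rotated]) (use fin in \<open>auto intro: finite_segments_within\<close>)
  also have "\<dots> = card ?X * card ?X" by (rule card_cartesian_product)
  also have "\<dots> \<le> (card P * m) * (card P * m)"
    using card_segments_within_le[OF fin order_refl] by (intro mult_le_mono) (auto simp: segments_within_def)
  finally show ?thesis by (simp add: power2_eq_square)
qed

definition congruent_segments :: "(real^2) set \<Rightarrow> ((real^2) \<times> (real^2) \<times> (real^2) \<times> (real^2)) set" where
  "congruent_segments P = {(p, q, p', q'). p \<in> P \<and> q \<in> P \<and> p' \<in> P \<and> q' \<in> P \<and> p \<noteq> q \<and>
     dist p q = dist p' q'}"

text \<open>Given \<open>p\<close> and \<open>(p', q')\<close>, the point \<open>q\<close> lies on
  the circle around \<open>p\<close> of radius \<open>dist p' q'\<close>. If it has at most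
  \<open>t\<close> points, there are \<open>card P\<close> choices of \<open>p\<close>,
  \<open>card P * m\<close> of \<open>(p', q')\<close> and \<open>t\<close> of \<open>q\<close>.
  Otherwise \<open>p\<close> lies in \<open>B\<close>, and the halves are counted
  independently.\<close>

lemma card_congruent_reach_le:
  fixes P :: "(real^2) set" and m t :: nat
  assumes fin: "finite P"
  defines "B \<equiv> {p \<in> P. \<exists>d>0. card (P \<inter> cball p d) \<le> m \<and> t \<le> card (P \<inter> sphere p d)}"
  shows "card {z \<in> congruent_segments P. reach P z \<le> m} \<le> (card P)\<^sup>2 * m * t + card B * card P * m\<^sup>2"
proof -
  let ?X = "segments_within P m"
  let ?XB = "SIGMA p:B. {q \<in> P. card (P \<inter> cball p (dist p q)) \<le> m}"
  \<comment> \<open>A circle with more than \<open>t\<close> points gets the empty set, so that at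
    most \<open>t\<close> candidates remain for every \<open>y\<close>.\<close>
  let ?q = "\<lambda>y. {q \<in> P. card (P \<inter> sphere (fst y) (dist (fst (snd y)) (snd (snd y)))) \<le> t
    \<and> q \<in> sphere (fst y) (dist (fst (snd y)) (snd (snd y)))}"
  let ?Y = "Sigma (P \<times> ?X) ?q"
  have BP: "B \<subseteq> P" by (auto simp: B_def)
  then have finB: "finite B" using fin finite_subset by blast
  have finX: "finite ?X" using fin by (rule finite_segments_within)
  have finXB: "finite ?XB" using fin finB by auto
  have finY: "finite ?Y" using fin finX by auto
  have sub: "{z \<in> congruent_segments P. reach P z \<le> m} \<subseteq>
    (\<lambda>((p, p', q'), q). (p, q, p', q')) ` ?Y \<union> (\<lambda>((p, q), p', q'). (p, q, p', q')) ` (?XB \<times> ?X)"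
  proof
    fix z assume "z \<in> {z \<in> congruent_segments P. reach P z \<le> m}"
    then obtain p q p' q' where z: "z = (p, q, p', q')" and P: "p \<in> P" "q \<in> P" "p' \<in> P" "q' \<in> P" "p \<noteq> q"
      and d: "dist p q = dist p' q'" and m: "card (P \<inter> cball p (dist p q)) \<le> m"
        "card (P \<inter> cball p' (dist p' q')) \<le> m"
      by (auto simp: congruent_segments_def reach_def)
    have X: "(p', q') \<in> ?X" using P m by (auto simp: segments_within_def)
    show "z \<in> (\<lambda>((p, p', q'), q). (p, q, p', q')) ` ?Y \<union> (\<lambda>((p, q), p', q'). (p, q, p', q')) ` (?XB \<times> ?X)"
    proof (cases "card (P \<inter> sphere p (dist p q)) \<le> t")
      case True
      then have "((p, p', q'), q) \<in> ?Y" using X P d by auto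
      then show ?thesis unfolding z by (intro UnI1 image_eqI[rotated]) auto
    next
      case False
      then have "p \<in> B" using P m unfolding B_def by (auto intro!: exI[of _ "dist p q"])
      then have "((p, q), p', q') \<in> ?XB \<times> ?X" using X P m by auto
      then show ?thesis unfolding z by (intro UnI2 image_eqI[rotated]) auto
    qed
  qed
  have "card {z \<in> congruent_segments P. reach P z \<le> m} \<le>
    card ((\<lambda>((p, p', q'), q). (p, q, p', q')) ` ?Y) + card ((\<lambda>((p, q), p', q'). (p, q, p', q')) ` (?XB \<times> ?X))"
    using finX finXB finY sub by (intro order_trans[OF card_mono card_Un_le]) auto
  also have "\<dots> \<le> card ?Y + card (?XB \<times> ?X)"
    using finX finXB finY by (intro add_mono card_image_le) auto
  also have "card ?Y \<le> (card P)\<^sup>2 * m * t"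
  proof -
    have "card ?Y = (\<Sum>y\<in>P \<times> ?X. card (?q y))" using fin finX by simp
    also have "\<dots> \<le> of_nat (card (P \<times> ?X)) * t"
    proof (rule sum_bounded_above)
      fix y
      show "card (?q y) \<le> t"
      proof (cases "card (P \<inter> sphere (fst y) (dist (fst (snd y)) (snd (snd y)))) \<le> t")
        case True
        then have "?q y = P \<inter> sphere (fst y) (dist (fst (snd y)) (snd (snd y)))" by auto
        then show ?thesis using True by simp
      next
        case False
        then have "?q y = {}" by auto
        then show ?thesis by (simp only: card.empty)
      qed
    qed
    also have "\<dots> = card P * card ?X * t" by (simp add: card_cartesian_product)
    also have "\<dots> \<le> card P * (card P * m) * t"
      using card_segments_within_le[OF fin order_refl, of m] by (intro mult_le_mono) (auto simp: segments_within_def)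
    finally show ?thesis by (simp add: power2_eq_square mult.assoc)
  qed
  also have "card (?XB \<times> ?X) \<le> card B * card P * m\<^sup>2"
  proof -
    have "card (?XB \<times> ?X) \<le> (card B * m) * (card P * m)"
      unfolding card_cartesian_product
      using card_segments_within_le[OF fin order_refl, of m] card_segments_within_le[OF fin BP, of m]
      by (intro mult_le_mono) (auto simp: segments_within_def)
    then show ?thesis by (simp add: power2_eq_square mult_ac)
  qed
  finally show ?thesis by simp
qed

lemma reach_bounds:
  assumes "finite P" "Q \<subseteq> P \<times> P \<times> P \<times> P" "z \<in> Q"
  shows "1 \<le> reach P z" "reach P z \<le> card P"
proof -
  obtain p q p' q' where z: "z = (p, q, p', q')" by (metis prod.exhaust)
  then have "p \<in> P" using assms by auto
  then have "p \<in> P \<inter> cball p (dist p q)" by auto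
  then have "card (P \<inter> cball p (dist p q)) > 0" using assms by (auto simp: card_gt_0_iff)
  then show "1 \<le> reach P z" by (auto simp: reach_def z)
  show "reach P z \<le> card P" using assms(1) by (auto simp: reach_def z intro: card_mono)
qed

lemma sum_reach_congruent_le:
  assumes fin: "finite P"
  shows "(\<Sum>z\<in>congruent_segments P. 1 / (real (reach P z))\<^sup>2) \<le> 2621472 * (real (card P))\<^sup>2"
proof -
  let ?N = "card P"
  have Q: "congruent_segments P \<subseteq> P \<times> P \<times> P \<times> P" by (auto simp: congruent_segments_def)
  have finQ: "finite (congruent_segments P)" by (rule finite_subset[OF Q]) (use fin in auto)
  \<comment> \<open>A crude number of ranges is harmless: the bounds \<open>scale\<close> decay
    geometrically.\<close>
  have "?N < 2 ^ ?N" by (rule less_exp)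
  also have "\<dots> \<le> (16::nat) ^ ?N" by (rule power_mono) auto
  finally have N16: "?N < 16 ^ ?N" .
  have scale: "real (card {z \<in> congruent_segments P. reach P z \<le> 16 ^ Suc j}) / 256 ^ j
    \<le> 1310736 * (real ?N)\<^sup>2 * (1 / 2) ^ j" for j
  proof -
    \<comment> \<open>A threshold \<open>b ^ j\<close> turns the two terms of
      \<open>card_congruent_reach_le\<close>, divided by \<open>256 ^ j\<close>, into multiples of
      \<open>(b / 16) ^ j\<close> and \<open>(16 / b^2) ^ j\<close>. Both decay for \<open>b\<close>
      strictly between 4 and 16; here \<open>b = 8\<close>.\<close>
    define B where "B = {p \<in> P. \<exists>d>0. card (P \<inter> cball p d) \<le> 16 ^ Suc j \<and> 8 ^ j \<le> card (P \<inter> sphere p d)}"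
    have "\<forall>p\<in>B. \<exists>d>0. card (P \<inter> cball p d) \<le> 16 ^ Suc j \<and> 8 ^ j \<le> card (P \<inter> sphere p d)"
      by (auto simp: B_def)
    then obtain d where d: "\<And>p. p \<in> B \<Longrightarrow> d p > 0 \<and> card (P \<inter> cball p (d p)) \<le> 16 ^ Suc j
        \<and> 8 ^ j \<le> card (P \<inter> sphere p (d p))" by metis
    have "card B * (8 ^ j)\<^sup>2 \<le> 320 * 16 ^ Suc j * ?N"
      by (rule card_rich_circle_centres_le[OF fin, of _ d]) (use d in \<open>auto simp: B_def\<close>)
    then have "real (card B * (8 ^ j)\<^sup>2) \<le> real (320 * 16 ^ Suc j * ?N)" by (simp only: of_nat_le_iff)
    moreover have "((8::real) ^ j)\<^sup>2 = 16 ^ j * 4 ^ j"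
      by (simp add: power2_eq_square power_mult_distrib[symmetric])
    ultimately have "16 ^ j * (real (card B) * 4 ^ j) \<le> 16 ^ j * (5120 * real ?N)" by (simp add: algebra_simps)
    then have "real (card B) * 4 ^ j \<le> 5120 * real ?N" by simp
    then have "real (card B) \<le> 5120 * real ?N * (1 / 4) ^ j" by (simp add: field_simps power_divide)
    also have "\<dots> \<le> 5120 * real ?N * (1 / 2) ^ j" by (intro mult_left_mono power_mono) auto
    finally have B: "real (card B) \<le> 5120 * real ?N * (1 / 2) ^ j" .
    have "real (card {z \<in> congruent_segments P. reach P z \<le> 16 ^ Suc j})
      \<le> real (?N\<^sup>2 * 16 ^ Suc j * 8 ^ j + card B * ?N * (16 ^ Suc j)\<^sup>2)"
      unfolding of_nat_le_iff B_def by (rule card_congruent_reach_le[OF fin])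
    also have "\<dots> = 16 * (real ?N)\<^sup>2 * (16 ^ j * 8 ^ j) + 256 * real ?N * real (card B) * (16 ^ j)\<^sup>2"
      by (simp add: power_mult_distrib)
    also have "(16::real) ^ j * 8 ^ j = 256 ^ j * (1 / 2) ^ j"
      by (simp add: power_mult_distrib[symmetric])
    also have "((16::real) ^ j)\<^sup>2 = 256 ^ j"
      by (simp add: power2_eq_square power_mult_distrib[symmetric])
    finally have "real (card {z \<in> congruent_segments P. reach P z \<le> 16 ^ Suc j})
      \<le> (16 * (real ?N)\<^sup>2 * (1 / 2) ^ j + 256 * real ?N * real (card B)) * 256 ^ j"
      by (simp add: algebra_simps)
    then have "real (card {z \<in> congruent_segments P. reach P z \<le> 16 ^ Suc j}) / 256 ^ j
      \<le> 16 * (real ?N)\<^sup>2 * (1 / 2) ^ j + 256 * real ?N * real (card B)"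
      by (simp add: pos_divide_le_eq)
    also have "\<dots> \<le> 16 * (real ?N)\<^sup>2 * (1 / 2) ^ j + 256 * real ?N * (5120 * real ?N * (1 / 2) ^ j)"
      using B by (intro add_left_mono mult_left_mono) auto
    \<comment> \<open>1310736 = 16 + 256 * 5120, where 5120 = 320 * 16. The geometric series doubles
      this at the end.\<close>
    also have "\<dots> = 1310736 * (real ?N)\<^sup>2 * (1 / 2) ^ j"
      by (simp add: power2_eq_square algebra_simps)
    finally show ?thesis .
  qed
  have "(\<Sum>z\<in>congruent_segments P. 1 / (real (reach P z))\<^sup>2)
    \<le> (\<Sum>j<?N. real (card {z \<in> congruent_segments P. reach P z \<le> 16 ^ Suc j}) / 256 ^ j)"
    by (rule sum_inverse_square_dyadic_le[OF finQ])
      (use reach_bounds[OF fin Q] N16 le_less_trans in blast)+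
  also have "\<dots> \<le> (\<Sum>j<?N. 1310736 * (real ?N)\<^sup>2 * (1 / 2) ^ j)"
    by (rule sum_mono) (rule scale)
  also have "\<dots> = 1310736 * (real ?N)\<^sup>2 * (\<Sum>j<?N. (1 / 2) ^ j)" by (simp add: sum_distrib_left)
  also have "(\<Sum>j<?N. (1 / 2 :: real) ^ j) \<le> 2"
    by (simp add: sum_gp_strict)
  finally show ?thesis by (simp add: mult_left_mono)
qed

lemma sum_reach_le:
  assumes fin: "finite P" and Q: "Q \<subseteq> P \<times> P \<times> P \<times> P" and N3: "card P \<ge> 3"
  shows "(\<Sum>z\<in>Q. 1 / (real (reach P z))\<^sup>2) \<le> 512 * (real (card P))\<^sup>2 * ln (real (card P))"
proof -
  let ?N = "card P"
  \<comment> \<open>\<open>J\<close> exceeds \<open>ln ?N\<close>, so \<open>exp J\<close> and all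
    the more \<open>16 ^ J\<close> exceed \<open>?N\<close>. As \<open>?N\<close> is at least 3, its
    logarithm is at least 1, and the rounding at most doubles it.\<close>
  define J where "J = nat \<lfloor>ln (real ?N)\<rfloor> + 1"
  have "exp 1 \<le> real ?N" using exp_le N3 by linarith
  then have "ln (exp 1) \<le> ln (real ?N)" using N3 by (subst ln_le_cancel_iff) auto
  then have ln1: "ln (real ?N) \<ge> 1" by simp
  then have J: "ln (real ?N) < real J" "real J \<le> 2 * ln (real ?N)"
    unfolding J_def by linarith+
  have "real ?N = exp (ln (real ?N))" using N3 by simp
  also have "\<dots> < exp (real J)" using J by simp
  also have "\<dots> = exp 1 ^ J" by (metis exp_of_nat_mult mult.right_neutral)
  also have "\<dots> \<le> 16 ^ J" by (rule power_mono) (use exp_le in linarith, simp)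
  finally have "real ?N < real (16 ^ J)" by simp
  then have N16: "?N < 16 ^ J" by (simp only: of_nat_less_iff)
  have finQ: "finite Q" by (rule finite_subset[OF Q]) (use fin in auto)
  have "(\<Sum>z\<in>Q. 1 / (real (reach P z))\<^sup>2) \<le> (\<Sum>j<J. real (card {z \<in> Q. reach P z \<le> 16 ^ Suc j}) / 256 ^ j)"
    by (rule sum_inverse_square_dyadic_le[OF finQ])
      (use reach_bounds[OF fin Q] N16 le_less_trans in blast)+
  \<comment> \<open>Every range gets the same bound from \<open>card_reach_le\<close>; without
    decay, the number of ranges survives as the logarithm.\<close>
  also have "\<dots> \<le> (\<Sum>j<J. 256 * (real ?N)\<^sup>2)"
  proof (rule sum_mono)
    fix j
    have "real (card {z \<in> Q. reach P z \<le> 16 ^ Suc j}) \<le> real ((?N * 16 ^ Suc j)\<^sup>2)"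
      unfolding of_nat_le_iff by (rule card_reach_le[OF fin Q])
    also have "\<dots> = 256 * (real ?N)\<^sup>2 * (16 ^ j)\<^sup>2" by (simp add: power_mult_distrib)
    also have "((16::real) ^ j)\<^sup>2 = 256 ^ j"
      by (simp add: power2_eq_square power_mult_distrib[symmetric])
    finally show "real (card {z \<in> Q. reach P z \<le> 16 ^ Suc j}) / 256 ^ j \<le> 256 * (real ?N)\<^sup>2"
      by (simp add: pos_divide_le_eq)
  qed
  also have "\<dots> = real J * (256 * (real ?N)\<^sup>2)" by simp
  also have "\<dots> \<le> 2 * ln (real ?N) * (256 * (real ?N)\<^sup>2)"
    using J by (intro mult_right_mono) auto
  finally show ?thesis by (simp add: mult_ac)
qed

section \<open>From triples of points to classes of triangles\<close>

text \<open>The line through distinct \<open>a\<close> and \<open>b\<close> misses at least half of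
  \<open>P\<close>, which leaves half of the points for \<open>c\<close>. The \<open>N - 1\<close>
  choices of \<open>b\<close> are at least \<open>N / 2\<close> because
  \<open>N >= 2\<close>.\<close>

lemma card_noncollinear_triples_ge:
  fixes P :: "(real^2) set"
  assumes fin: "finite P" and N2: "card P \<ge> 2"
    and lines: "\<And>L. is_line L \<Longrightarrow> real (card (P \<inter> L)) \<le> real (card P) / 2"
  shows "real (card P) ^ 3 / 4 \<le> real (card {(a, b, c). a \<in> P \<and> b \<in> P \<and> c \<in> P \<and> \<not> collinear {a, b, c}})"
proof -
  let ?N = "real (card P)"
  let ?S = "SIGMA a:P. SIGMA b:P - {a}. P - affine hull {a, b}"
  have off: "?N / 2 \<le> real (card (P - affine hull {a, b}))" if "a \<noteq> b" for a b
  proof -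
    have "is_line (affine hull {a, b})" using that by (simp add: is_line_def aff_dim_2)
    then have "real (card (P \<inter> affine hull {a, b})) \<le> ?N / 2" by (rule lines)
    moreover have "card P = card (P \<inter> affine hull {a, b}) + card (P - affine hull {a, b})"
      using fin by (metis card_Int_Diff)
    ultimately show ?thesis by linarith
  qed
  have "?N ^ 3 / 4 = ?N * ((?N / 2) * (?N / 2))" by (simp add: power3_eq_cube)
  also have "\<dots> \<le> ?N * ((?N - 1) * (?N / 2))"
    using N2 by (intro mult_left_mono mult_right_mono) auto
  also have "\<dots> = (\<Sum>a\<in>P. (?N - 1) * (?N / 2))" by simp
  also have "\<dots> \<le> (\<Sum>a\<in>P. real (card (SIGMA b:P - {a}. P - affine hull {a, b})))"
  proof (rule sum_mono)
    fix a assume a: "a \<in> P"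
    have "(?N - 1) * (?N / 2) = (\<Sum>b\<in>P - {a}. ?N / 2)"
      using a fin N2 by (simp add: of_nat_diff)
    also have "\<dots> \<le> (\<Sum>b\<in>P - {a}. real (card (P - affine hull {a, b})))"
      by (rule sum_mono) (use off in auto)
    also have "\<dots> = real (card (SIGMA b:P - {a}. P - affine hull {a, b}))" using fin by simp
    finally show "(?N - 1) * (?N / 2) \<le> real (card (SIGMA b:P - {a}. P - affine hull {a, b}))" .
  qed
  also have "\<dots> = real (card ?S)" using fin by simp
  also have "\<dots> \<le> real (card {(a, b, c). a \<in> P \<and> b \<in> P \<and> c \<in> P \<and> \<not> collinear {a, b, c}})"
  proof (rule of_nat_mono, rule card_mono)
    show "finite {(a, b, c). a \<in> P \<and> b \<in> P \<and> c \<in> P \<and> \<not> collinear {a, b, c}}"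
      by (rule finite_subset[of _ "P \<times> P \<times> P"]) (use fin in auto)
    show "?S \<subseteq> {(a, b, c). a \<in> P \<and> b \<in> P \<and> c \<in> P \<and> \<not> collinear {a, b, c}}"
      by (auto simp: collinear_3_affine_hull)
  qed
  finally show ?thesis .
qed

text \<open>Cauchy-Schwarz for the sizes of the fibres, whose squares add up to the number of pairs
  with equal value.\<close>

lemma card_square_le_fibres:
  assumes "finite T" "finite C" "f ` T \<subseteq> C"
  shows "(real (card T))\<^sup>2 \<le> real (card {(s, t). s \<in> T \<and> t \<in> T \<and> f s = f t}) * real (card C)"
proof -
  have "card T = (\<Sum>c\<in>C. card {t \<in> T. f t = c})"
    using sum.group[OF assms, of "\<lambda>_. 1 :: nat"] by simp
  then have "(real (card T))\<^sup>2 = (\<Sum>c\<in>C. real (card {t \<in> T. f t = c}))\<^sup>2" by simp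
  also have "\<dots> \<le> (\<Sum>c\<in>C. (real (card {t \<in> T. f t = c}))\<^sup>2) * real (card C)"
    by (rule sum_squared_le_sum_of_squares)
  also have "(\<Sum>c\<in>C. (real (card {t \<in> T. f t = c}))\<^sup>2) = real (\<Sum>c\<in>C. card ({t \<in> T. f t = c} \<times> {t \<in> T. f t = c}))"
    by (simp add: card_cartesian_product power2_eq_square)
  also have "(\<Sum>c\<in>C. card ({t \<in> T. f t = c} \<times> {t \<in> T. f t = c})) = card (\<Union>c\<in>C. {t \<in> T. f t = c} \<times> {t \<in> T. f t = c})"
    by (rule card_UN_disjoint[symmetric]) (use assms in auto)
  also have "(\<Union>c\<in>C. {t \<in> T. f t = c} \<times> {t \<in> T. f t = c}) = {(s, t). s \<in> T \<and> t \<in> T \<and> f s = f t}"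
    using assms(3) by auto
  finally show ?thesis .
qed

text \<open>\<open>\<Phi>\<close> stands for isometries or similarities, and \<open>Q\<close> for
  the quadruples they can realise. In 497664 = 16 * 6 * 4 * 36^2 the 16 comes from squaring
  \<open>N^3 / 4\<close>, the 6 from the orders of the vertices, the rest from
  \<open>sum_cubed_richness_le\<close>.\<close>

lemma card_triangle_classes_ge:
  fixes P :: "(real^2) set" and \<Phi> :: "(real^2 \<Rightarrow> real^2) \<Rightarrow> bool"
  assumes fin: "finite P" "finite Q" and N2: "card P \<ge> 2"
    and lines: "\<And>L. is_line L \<Longrightarrow> real (card (P \<inter> L)) \<le> real (card P) / 2"
    and sim: "\<And>f. \<Phi> f \<Longrightarrow> plane_similarity f"
    and r: "r = {(S, T). S \<in> triangles P \<and> T \<in> triangles P \<and> (\<exists>f. \<Phi> f \<and> f ` S = T)}"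
    and eq: "equiv (triangles P) r"
    and Q: "\<And>g p q. \<Phi> g \<Longrightarrow> p \<in> P \<Longrightarrow> q \<in> P \<Longrightarrow> g p \<in> P \<Longrightarrow> g q \<in> P \<Longrightarrow> p \<noteq> q \<Longrightarrow>
      (p, q, g p, g q) \<in> Q"
    and Q_distinct: "\<And>p q p' q'. (p, q, p', q') \<in> Q \<Longrightarrow> p \<noteq> q"
  shows "real (card P) ^ 4 \<le>
    497664 * (\<Sum>z\<in>Q. 1 / (real (reach P z))\<^sup>2) * real (card (triangles P // r))"
proof -
  let ?N = "real (card P)"
  define T where "T = {(a, b, c). a \<in> P \<and> b \<in> P \<and> c \<in> P \<and> \<not> collinear {a, b, c}}"
  define vs where "vs t = (case t of (a, b, c) \<Rightarrow> {a, b, c})" for t :: "(real^2) \<times> (real^2) \<times> (real^2)"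
  define map3 where "map3 g t = (case t of (a, b, c) \<Rightarrow> (g a, g b, g c))"
    for g :: "real^2 \<Rightarrow> real^2" and t :: "(real^2) \<times> (real^2) \<times> (real^2)"
  have finT: "finite T" by (rule finite_subset[of _ "P \<times> P \<times> P"]) (use fin in \<open>auto simp: T_def\<close>)
  have distinctT: "a \<noteq> b \<and> b \<noteq> c \<and> a \<noteq> c" if "(a, b, c) \<in> T" for a b c
    using that by (auto simp: T_def insert_commute)
  have vsT: "vs t \<in> triangles P" if "t \<in> T" for t
  proof -
    obtain a b c where t: "t = (a, b, c)" by (metis prod.exhaust)
    show ?thesis using that distinctT[of a b c] by (auto simp: t vs_def triangles_def T_def)
  qed
  have fin_tri: "finite (triangles P)"
    by (rule finite_subset[of _ "Pow P"]) (use fin in \<open>auto simp: triangles_def\<close>)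
  have fin_cls: "finite (triangles P // r)"
    by (rule finite_quotient[OF fin_tri]) (auto simp: r)
  define S where "S = {(s, t). s \<in> T \<and> t \<in> T \<and> r `` {vs s} = r `` {vs t}}"
  have TS: "(real (card T))\<^sup>2 \<le> real (card S) * real (card (triangles P // r))"
    unfolding S_def by (rule card_square_le_fibres[OF finT fin_cls]) (use vsT in \<open>auto intro: quotientI\<close>)
  define E where "E = {(s, t). s \<in> T \<and> t \<in> T \<and> (\<exists>f. \<Phi> f \<and> map3 f s = t)}"
  have finE: "finite E" by (rule finite_subset[of _ "T \<times> T"]) (use finT in \<open>auto simp: E_def\<close>)
  \<comment> \<open>Equivalent triangles are matched only as vertex sets. One of six reorderings of
    the second triple turns a pair in \<open>E\<close>, matched vertex by vertex, into the given
    pair in \<open>S\<close>.\<close>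
  define perms where "perms = set [\<lambda>(a, b, c). (a, b, c), \<lambda>(a, b, c). (a, c, b), \<lambda>(a, b, c). (b, a, c),
    \<lambda>(a, b, c). (b, c, a), \<lambda>(a, b, c). (c, a, b), \<lambda>(a, b, c :: real^2). (c, b, a)]"
  have "S \<subseteq> (\<Union>\<sigma>\<in>perms. (\<lambda>(s, t). (s, \<sigma> t)) ` E)"
  proof
    fix z assume z: "z \<in> S"
    obtain a b c a' b' c' where zz: "z = ((a, b, c), (a', b', c'))" by (metis prod.exhaust)
    then have T: "(a, b, c) \<in> T" "(a', b', c') \<in> T" and
      "r `` {vs (a, b, c)} = r `` {vs (a', b', c')}" using z by (auto simp: S_def)
    then have "(vs (a, b, c), vs (a', b', c')) \<in> r"
      using eq_equiv_class[OF _ eq vsT[OF T(2)]] by simp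
    then obtain f where f: "\<Phi> f" "f ` {a, b, c} = {a', b', c'}" by (auto simp: r vs_def)
    have f3: "{f a, f b, f c} = {a', b', c'}" using f(2) by simp
    have "inj f" using sim[OF f(1)] plane_similarity_bij bij_is_inj by auto
    then have ne: "f a \<noteq> f b" "f b \<noteq> f c" "f a \<noteq> f c"
      using distinctT[OF T(1)] by (auto simp: inj_eq)
    have "(f a, f b, f c) \<in> T" using T(2) f3 by (auto simp: T_def)
    then have E: "((a, b, c), (f a, f b, f c)) \<in> E" using T f(1) by (auto simp: E_def map3_def)
    have ne': "a' \<noteq> b' \<and> b' \<noteq> c' \<and> a' \<noteq> c'" using distinctT[OF T(2)] .
    have "a' \<in> {f a, f b, f c}" "b' \<in> {f a, f b, f c}" "c' \<in> {f a, f b, f c}" unfolding f3 by auto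
    then have "(a', b', c') = (f a, f b, f c) \<or> (a', b', c') = (f a, f c, f b) \<or>
      (a', b', c') = (f b, f a, f c) \<or> (a', b', c') = (f b, f c, f a) \<or>
      (a', b', c') = (f c, f a, f b) \<or> (a', b', c') = (f c, f b, f a)"
      using ne' by auto
    then have "\<exists>\<sigma>\<in>perms. (a', b', c') = \<sigma> (f a, f b, f c)"
      unfolding perms_def by auto
    then obtain \<sigma> where s: "\<sigma> \<in> perms" "(a', b', c') = \<sigma> (f a, f b, f c)" by blast
    have "z \<in> (\<lambda>(s, t). (s, \<sigma> t)) ` E"
      by (rule image_eqI[OF _ E]) (simp add: zz s(2)[symmetric])
    then show "z \<in> (\<Union>\<sigma>\<in>perms. (\<lambda>(s, t). (s, \<sigma> t)) ` E)" using s(1) by blast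
  qed
  then have "card S \<le> card (\<Union>\<sigma>\<in>perms. (\<lambda>(s, t). (s, \<sigma> t)) ` E)"
    by (rule card_mono[rotated]) (use finE in \<open>auto simp: perms_def\<close>)
  also have "\<dots> \<le> (\<Sum>\<sigma>\<in>perms. card ((\<lambda>(s, t). (s, \<sigma> t)) ` E))"
    by (rule card_UN_le) (simp add: perms_def)
  also have "\<dots> \<le> of_nat (card perms) * card E"
    by (rule sum_bounded_above) (rule card_image_le[OF finE])
  also have "\<dots> \<le> 6 * card E"
    unfolding perms_def using card_length[of "[\<lambda>(a, b, c). (a, b, c), \<lambda>(a, b, c). (a, c, b), \<lambda>(a, b, c). (b, a, c),
    \<lambda>(a, b, c). (b, c, a), \<lambda>(a, b, c). (c, a, b), \<lambda>(a, b, c :: real^2). (c, b, a)]"]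
    by (intro mult_right_mono) (simp_all del: set_simps)
  finally have SE: "card S \<le> 6 * card E" .
  \<comment> \<open>One map is picked for each pair in \<open>E\<close>, which keeps
    \<open>G\<close> finite.\<close>
  define \<phi> where "\<phi> z = (SOME f. \<Phi> f \<and> map3 f (fst z) = snd z)" for z
  have \<phi>: "\<Phi> (\<phi> z) \<and> map3 (\<phi> z) (fst z) = snd z" if "z \<in> E" for z
  proof -
    have "\<exists>f. \<Phi> f \<and> map3 f (fst z) = snd z" using that by (auto simp: E_def)
    from someI_ex[OF this] show ?thesis unfolding \<phi>_def .
  qed
  define G where "G = \<phi> ` E"
  define A where "A g = {p \<in> P. g p \<in> P}" for g :: "real^2 \<Rightarrow> real^2"
  have finA: "finite (A g)" for g using fin by (auto simp: A_def)
  have inA: "a \<in> A (\<phi> z) \<and> b \<in> A (\<phi> z) \<and> c \<in> A (\<phi> z)" if "z \<in> E" "fst z = (a, b, c)" for a b c z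
  proof -
    have "snd z = (\<phi> z a, \<phi> z b, \<phi> z c)" using \<phi>[OF that(1)] that(2) by (simp add: map3_def)
    then show ?thesis using that by (cases z) (auto simp: E_def T_def A_def)
  qed
  have rich: "card (A g) \<ge> 2" if "g \<in> G" for g
  proof -
    obtain z where z: "z \<in> E" "g = \<phi> z" using \<open>g \<in> G\<close> by (auto simp: G_def)
    obtain a b c where abc: "fst z = (a, b, c)" by (metis prod.exhaust)
    have "(a, b, c) \<in> T" using z(1) abc by (auto simp: E_def)
    then have "a \<noteq> b" using distinctT by auto
    then have "card {a, b} = 2" by simp
    moreover have "{a, b} \<subseteq> A g" using inA[OF z(1) abc] z(2) by auto
    ultimately show ?thesis using card_mono[OF finA[of g], of "{a, b}"] by simp
  qed
  \<comment> \<open>A pair in \<open>E\<close> is recovered from its map \<open>g\<close> and its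
    first triple, whose vertices all lie in \<open>A g\<close>. So \<open>g\<close> accounts for at
    most \<open>card (A g) ^ 3\<close> pairs.\<close>
  have "E \<subseteq> (\<Union>g\<in>G. (\<lambda>t. (t, map3 g t)) ` (A g \<times> A g \<times> A g))"
  proof
    fix z assume z: "z \<in> E"
    obtain a b c where abc: "fst z = (a, b, c)" by (metis prod.exhaust)
    have "z = (fst z, map3 (\<phi> z) (fst z))" using \<phi>[OF z] by simp
    moreover have "fst z \<in> A (\<phi> z) \<times> A (\<phi> z) \<times> A (\<phi> z)" using inA[OF z abc] abc by simp
    ultimately have "z \<in> (\<lambda>t. (t, map3 (\<phi> z) t)) ` (A (\<phi> z) \<times> A (\<phi> z) \<times> A (\<phi> z))" by (rule image_eqI)
    then show "z \<in> (\<Union>g\<in>G. (\<lambda>t. (t, map3 g t)) ` (A g \<times> A g \<times> A g))" using z by (auto simp only: G_def)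
  qed
  then have "card E \<le> card (\<Union>g\<in>G. (\<lambda>t. (t, map3 g t)) ` (A g \<times> A g \<times> A g))"
    by (rule card_mono[rotated]) (use finE finA in \<open>auto simp: G_def\<close>)
  also have "\<dots> \<le> (\<Sum>g\<in>G. card ((\<lambda>t. (t, map3 g t)) ` (A g \<times> A g \<times> A g)))"
    by (rule card_UN_le) (use finE in \<open>auto simp: G_def\<close>)
  also have "\<dots> \<le> (\<Sum>g\<in>G. card (A g \<times> A g \<times> A g))"
    by (rule sum_mono, rule card_image_le) (use finA in auto)
  also have "\<dots> = (\<Sum>g\<in>G. card (A g) ^ 3)" by (simp add: card_cartesian_product power3_eq_cube mult.assoc)
  finally have "real (card E) \<le> real (\<Sum>g\<in>G. card (A g) ^ 3)" by (simp only: of_nat_le_iff)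
  also have "\<dots> = (\<Sum>g\<in>G. real (card {p \<in> P. g p \<in> P}) ^ 3)" by (simp add: A_def)
  also have "\<dots> \<le> 4 * (36 * ?N)\<^sup>2 * (\<Sum>z\<in>Q. 1 / (real (reach P z))\<^sup>2)"
  proof (rule sum_cubed_richness_le[OF fin(1) _ fin(2)])
    show "finite G" using finE by (simp add: G_def)
    have G\<Phi>: "\<Phi> g" if "g \<in> G" for g using that \<phi> by (auto simp: G_def)
    show "plane_similarity g" if "g \<in> G" for g using sim G\<Phi> that by blast
    show "card {p \<in> P. g p \<in> P} \<ge> 2" if "g \<in> G" for g using rich[OF that] by (simp add: A_def)
    show "(p, q, g p, g q) \<in> Q" if "g \<in> G" "p \<in> P" "q \<in> P" "g p \<in> P" "g q \<in> P" "p \<noteq> q" for g p q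
      using Q G\<Phi> that by blast
    show "p \<noteq> q" if "(p, q, p', q') \<in> Q" for p q p' q' using Q_distinct that by blast
  qed
  finally have E: "real (card E) \<le> 4 * (36 * ?N)\<^sup>2 * (\<Sum>z\<in>Q. 1 / (real (reach P z))\<^sup>2)" .
  have "(?N ^ 3 / 4)\<^sup>2 \<le> (real (card T))\<^sup>2"
    using card_noncollinear_triples_ge[OF fin(1) N2 lines] unfolding T_def by (intro power_mono) auto
  also note TS
  also have "real (card S) * real (card (triangles P // r))
    \<le> (6 * (4 * (36 * ?N)\<^sup>2 * (\<Sum>z\<in>Q. 1 / (real (reach P z))\<^sup>2))) * real (card (triangles P // r))"
    using SE E by (intro mult_right_mono) (linarith, simp)
  finally have "(?N ^ 3 / 4)\<^sup>2 \<le> (6 * (4 * (36 * ?N)\<^sup>2 * (\<Sum>z\<in>Q. 1 / (real (reach P z))\<^sup>2))) * real (card (triangles P // r))" .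
  moreover have "(?N ^ 3 / 4)\<^sup>2 = ?N\<^sup>2 * (?N ^ 4 / 16)"
    by (simp add: power_divide power_mult[symmetric] power_add[symmetric])
  moreover have "(6 * (4 * (36 * ?N)\<^sup>2 * (\<Sum>z\<in>Q. 1 / (real (reach P z))\<^sup>2))) * real (card (triangles P // r))
    = ?N\<^sup>2 * (31104 * (\<Sum>z\<in>Q. 1 / (real (reach P z))\<^sup>2) * real (card (triangles P // r)))"
    by (simp add: power_mult_distrib)
  ultimately have "?N\<^sup>2 * (?N ^ 4 / 16)
    \<le> ?N\<^sup>2 * (31104 * (\<Sum>z\<in>Q. 1 / (real (reach P z))\<^sup>2) * real (card (triangles P // r)))" by simp
  moreover have "?N\<^sup>2 > 0" using N2 by auto
  ultimately have "?N ^ 4 / 16 \<le> 31104 * (\<Sum>z\<in>Q. 1 / (real (reach P z))\<^sup>2) * real (card (triangles P // r))"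
    by (simp only: mult_le_cancel_left_pos)
  then show ?thesis by simp
qed

section \<open>The two lower bounds\<close>

text \<open>Serves both bounds: \<open>K\<close> is a constant for congruence and
  \<open>512 * ln N\<close> for similarity.\<close>

lemma divide_le_of_fourth_power_le:
  fixes N K c s :: real
  assumes "N > 0" "K > 0" "c \<ge> 0" "N ^ 4 \<le> 497664 * s * c" "s \<le> K * N\<^sup>2"
  shows "N\<^sup>2 / (497664 * K) \<le> c"
proof -
  have "497664 * s * c \<le> 497664 * (K * N\<^sup>2) * c"
    using assms(3,5) by (intro mult_right_mono mult_left_mono) auto
  also have "\<dots> = N\<^sup>2 * (497664 * K * c)" by (simp only: mult_ac)
  finally have "N ^ 4 \<le> N\<^sup>2 * (497664 * K * c)" using assms(4) by linarith
  moreover have "N ^ 4 = N\<^sup>2 * N\<^sup>2" unfolding power_add[symmetric] by simp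
  ultimately have "N\<^sup>2 * N\<^sup>2 \<le> N\<^sup>2 * (497664 * K * c)" by (simp only:)
  then have "N\<^sup>2 \<le> 497664 * K * c"
    by (rule mult_left_le_imp_le) (use assms(1) in simp)
  then show ?thesis using assms(2) by (simp add: pos_divide_le_eq mult_ac)
qed

theorem theorem3:
  shows "\<exists>c1 > (0::real). \<exists>c2 > (0::real). \<exists>N0::nat. \<forall>(N::nat) (P::(real^2) set).
    N \<ge> N0 \<longrightarrow> finite P \<longrightarrow> card P = N \<longrightarrow>
    (\<forall>L. is_line L \<longrightarrow> real (card (P \<inter> L)) \<le> real N / 2) \<longrightarrow>
      real (card (congruence_classes P)) \<ge> c1 * real N ^ 2 \<and>
      real (card (similarity_classes P)) \<ge> c2 * (real N ^ 2 / ln (real N))"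
proof -
  let ?c1 = "1 / (497664 * 2621472) :: real" and ?c2 = "1 / (497664 * 512) :: real"
  have main: "real (card (congruence_classes P)) \<ge> ?c1 * real N ^ 2 \<and>
      real (card (similarity_classes P)) \<ge> ?c2 * (real N ^ 2 / ln (real N))"
    if N3: "N \<ge> 3" and fin: "finite P" and N: "card P = N"
      and lines: "\<And>L. is_line L \<Longrightarrow> real (card (P \<inter> L)) \<le> real (card P) / 2"
    for N and P :: "(real^2) set"
  proof
    have N2: "card P \<ge> 2" and N0: "real N > 0" using N N3 by auto
    have "finite (congruent_segments P)"
      by (rule finite_subset[of _ "P \<times> P \<times> P \<times> P"]) (use fin in \<open>auto simp: congruent_segments_def\<close>)
    then have "real (card P) ^ 4 \<le> 497664 * (\<Sum>z\<in>congruent_segments P. 1 / (real (reach P z))\<^sup>2)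
        * real (card (congruence_classes P))"
      unfolding congruence_classes_def
    proof (rule card_triangle_classes_ge[OF fin _ N2 lines _ congruence_on_def equiv_congruence_on])
      show "plane_similarity f" if "plane_isometry f" for f
        using that unfolding plane_isometry_def plane_similarity_iff by (intro exI[of _ 1]) simp
    qed (auto simp: congruent_segments_def plane_isometry_def)
    from divide_le_of_fourth_power_le[OF N0 _ _ this[unfolded N] sum_reach_congruent_le[OF fin, unfolded N]]
    have "(real N)\<^sup>2 / (497664 * 2621472) \<le> real (card (congruence_classes P))" by simp
    then show "real (card (congruence_classes P)) \<ge> ?c1 * real N ^ 2" by simp
    \<comment> \<open>Similarities may change lengths, so unlike in
      \<open>congruent_segments\<close> no distances are equated.\<close>
    define Q where "Q = {(p, q, p', q'). p \<in> P \<and> q \<in> P \<and> p' \<in> P \<and> q' \<in> P \<and> p \<noteq> q}"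
    have QP: "Q \<subseteq> P \<times> P \<times> P \<times> P" by (auto simp: Q_def)
    then have "finite Q" by (rule finite_subset) (use fin in auto)
    then have *: "real (card P) ^ 4 \<le> 497664 * (\<Sum>z\<in>Q. 1 / (real (reach P z))\<^sup>2)
        * real (card (similarity_classes P))"
      unfolding similarity_classes_def
      by (rule card_triangle_classes_ge[OF fin _ N2 lines _ similarity_on_def equiv_similarity_on])
        (auto simp: Q_def)
    have le: "(\<Sum>z\<in>Q. 1 / (real (reach P z))\<^sup>2) \<le> (512 * ln (real N)) * (real N)\<^sup>2"
      using sum_reach_le[OF fin QP] N N3 by (simp add: mult_ac)
    have "512 * ln (real N) > 0" using N3 by simp
    from divide_le_of_fourth_power_le[OF N0 this of_nat_0_le_iff *[unfolded N] le]
    have "(real N)\<^sup>2 / (497664 * (512 * ln (real N))) \<le> real (card (similarity_classes P))" .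
    then show "real (card (similarity_classes P)) \<ge> ?c2 * (real N ^ 2 / ln (real N))" by simp
  qed
  \<comment> \<open>The threshold 3 ensures \<open>ln N >= 1\<close>.\<close>
  show ?thesis
    by (rule exI[of _ ?c1], rule conjI, simp, rule exI[of _ ?c2], rule conjI, simp, rule exI[of _ 3])
      (use main in auto)
qed

end
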